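(* Let $2\le n<\infty$. Every $\mathbb{Z}_3$-symmetric solution for the cells of $\mathcal{D}^{(2n+1)\ast}$ is equivalent to the solution $$W_{i_1,j_2,k_2}=W_{i_2,j_1,k_2}=W_{i_2,j_2,k_1}=\sqrt{[2][3]},$$ $$W_{i_l,j_{l+1},k_{l+1}}=W_{i_{l+1},j_l,k_{l+1}}=W_{i_{l+1},j_{l+1},k_l}=\frac{\sqrt{[l+1][2l-1][2l+1]}}{\sqrt{[l]}},$$ $$W_{i_l,j_l,k_{l+1}}=W_{i_l,j_{l+1},k_l}=W_{i_{l+1},j_l,k_l}=\frac{\sqrt{[l-1][2l-1][2l+1]}}{\sqrt{[l]}},$$ $$W_{i_l,j_l,k_l}=(-1)^{l+1}\frac{[2l-1]}{\sqrt{[l-1][l]}},\qquad W_{i_n,j_n,k_n}=(-1)^{n+1}\frac{[2n-1]}{\sqrt{[n-1][n]}},$$ for $l=2,\ldots,n-1$.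
   Context: Let $q=e^{\pi i/(2n+1)}$ and $[m]=(q^m-q^{-m})/(q-q^{-1})$. The graph $\mathcal{D}^{(2n+1)\ast}$ has vertices $i_l,j_l,k_l$, $l=1,\ldots,n$. For each pair $(l,m)\in\{1,\ldots,n\}^2$ with $|l-m|\le 1$ and $(l,m)\neq(1,1)$ there is exactly one edge $i_l\to j_m$, one edge $j_l\to k_m$ and one edge $k_l\to i_m$; there are no other edges. Its Perron-Frobenius eigenvector (eigenvalue $[3]$) is $\phi_{i_l}=\phi_{j_l}=\phi_{k_l}=[2l-1]$. $W_{a,b,c}$ denotes the value of $W$ on the triangle $a\to b\to c\to a$. A cell system $W$ on this graph is called a $\mathbb{Z}_3$-symmetric solution if $|W_{i_p,j_q,k_r}|=|W_{i_q,j_r,k_p}|=|W_{i_r,j_p,k_q}|$ for all triangles. Cell systems: let $\mathcal{G}$ be a directed graph (loops and multiple edges allowed), with source and range maps $s,r$, Perron-Frobenius eigenvalue $[3]$ and positive Perron-Frobenius eigenvector $(\phi_i)$. A triangle $\triangle_{ijk}^{(\alpha\beta\gamma)}$ is a closed path $i\xrightarrow{\alpha}j\xrightarrow{\beta}k\xrightarrow{\gamma}i$, considered up to cyclic rotation. A cell system $W$ assigns to each triangle a complex number $W(\triangle_{ijk}^{(\alpha\beta\gamma)})$ such that: (I) for all edges $\alpha,\alpha'$ from $i$ to $j$, $\sum_{k,\beta,\gamma}W(\triangle_{ijk}^{(\alpha\beta\gamma)})\overline{W(\triangle_{ijk}^{(\alpha'\beta\gamma)})}=\delta_{\alpha,\alpha'}[2]\phi_i\phi_j$,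 the sum being over vertices $k$ and edges $\beta:j\to k$, $\gamma:k\to i$; (II) for all edges $\alpha_1,\dots,\alpha_4$ with $s(\alpha_1)=s(\alpha_4)=i_1$, $r(\alpha_1)=r(\alpha_2)=i_2$, $s(\alpha_2)=s(\alpha_3)=i_3$, $r(\alpha_3)=r(\alpha_4)=i_4$ (here $i_1,\dots,i_4$ are arbitrary vertices of $\mathcal{G}$), $$\sum\phi_k^{-1}W(\triangle_{i_1i_2k}^{(\alpha_1\beta_1\beta_2)})\overline{W(\triangle_{i_3i_2k}^{(\alpha_2\beta_1\beta_3)})}W(\triangle_{i_3i_4k}^{(\alpha_3\beta_4\beta_3)})\overline{W(\triangle_{i_1i_4k}^{(\alpha_4\beta_4\beta_2)})}=\delta_{\alpha_1,\alpha_4}\delta_{\alpha_2,\alpha_3}\phi_{i_1}\phi_{i_2}\phi_{i_3}+\delta_{\alpha_1,\alpha_2}\delta_{\alpha_3,\alpha_4}\phi_{i_1}\phi_{i_2}\phi_{i_4},$$ the sum being over vertices $k$ and edges $\beta_1:i_2\to k$, $\beta_2:k\to i_1$, $\beta_3:k\to i_3$, $\beta_4:i_4\to k$. Two cell systems $W_1,W_2$ on $\mathcal{G}$ are equivalent if for each pair of adjacent vertices $i,j$ there is a unitary matrix $(u(\sigma,\sigma'))$ indexed by the edges from $i$ to $j$ such that for every triangle $W_1(\triangle_{ijk}^{(\sigma\rho\gamma)})=\sum_{\sigma',\rho',\gamma'}u(\sigma,\sigma')u(\rho,\rho')u(\gamma,\gamma')W_2(\triangle_{ijk}^{(\sigma'\rho'\gamma')})$,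 summing over edges $\sigma':i\to j$, $\rho':j\to k$, $\gamma':k\to i$. *)

theory Defs
  imports Complex_Main "Graph_Theory.Digraph"
begin

section \<open>Quantum integers\<close>

text \<open>
  Quantum integers are used only for \<open>q\<close> on the unit circle, where the quotient below is real
  (lemma \<open>qint_eq\<close>); \<open>Re\<close> merely moves it into type \<^typ>\<open>real\<close>.
\<close>

definition qint :: "complex \<Rightarrow> nat \<Rightarrow> real" where
  "qint q m = Re ((q ^ m - inverse q ^ m) / (q - inverse q))"

lemma qint_eq:
  assumes "cmod q = 1"
  shows "complex_of_real (qint q m) = (q ^ m - inverse q ^ m) / (q - inverse q)"
proof -
  have inv: "inverse q = cnj q"
    using assms complex_norm_square[of q] by (intro inverse_unique) simp
  have "cnj ((q ^ m - inverse q ^ m) / (q - inverse q)) = (q ^ m - inverse q ^ m) / (q - inverse q)"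
    unfolding inv by (simp add: divide_simps) (auto simp: algebra_simps)
  then show ?thesis
    unfolding qint_def by (metis Reals_cnj_iff of_real_Re)
qed


section \<open>Cell systems on directed multigraphs\<close>

definition edges :: "('v, 'e) pre_digraph \<Rightarrow> 'v \<Rightarrow> 'v \<Rightarrow> 'e set" where
  "edges G u v = {e \<in> arcs G. tail G e = u \<and> head G e = v}"

text \<open>
  A positive eigenvector of a nonnegative matrix belongs to its spectral radius, so positivity
  of \<open>\<phi>\<close> is what makes \<open>\<lambda>\<close> the Perron--Frobenius eigenvalue of the adjacency matrix of \<open>G\<close>.
\<close>

definition PF_eigenvector :: "('v, 'e) pre_digraph \<Rightarrow> real \<Rightarrow> ('v \<Rightarrow> real) \<Rightarrow> bool" where
  "PF_eigenvector G l \<phi> \<longleftrightarrow>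
     (\<forall>v \<in> verts G. \<phi> v > 0) \<and>
     (\<forall>v \<in> verts G. (\<Sum>e \<in> out_arcs G v. \<phi> (head G e)) = l * \<phi> v)"

definition triangle :: "('v, 'e) pre_digraph \<Rightarrow> 'e \<Rightarrow> 'e \<Rightarrow> 'e \<Rightarrow> bool" where
  "triangle G \<alpha> \<beta> \<gamma> \<longleftrightarrow>
     \<alpha> \<in> arcs G \<and> \<beta> \<in> arcs G \<and> \<gamma> \<in> arcs G \<and>
     head G \<alpha> = tail G \<beta> \<and> head G \<beta> = tail G \<gamma> \<and> head G \<gamma> = tail G \<alpha>"

text \<open>
  A function on triangles up to cyclic rotation is a function \<open>W\<close> of the three consecutive
  edges which is invariant under rotation; values of \<open>W\<close> off the triangles are irrelevant.
\<close>

definition rotation_invariant ::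
    "('v, 'e) pre_digraph \<Rightarrow> ('e \<Rightarrow> 'e \<Rightarrow> 'e \<Rightarrow> complex) \<Rightarrow> bool" where
  "rotation_invariant G W \<longleftrightarrow>
     (\<forall>\<alpha> \<beta> \<gamma>. triangle G \<alpha> \<beta> \<gamma> \<longrightarrow> W \<alpha> \<beta> \<gamma> = W \<beta> \<gamma> \<alpha>)"

definition type_I ::
    "complex \<Rightarrow> ('v, 'e) pre_digraph \<Rightarrow> ('v \<Rightarrow> real) \<Rightarrow> ('e \<Rightarrow> 'e \<Rightarrow> 'e \<Rightarrow> complex) \<Rightarrow> bool" where
  "type_I q G \<phi> W \<longleftrightarrow>
     (\<forall>i \<in> verts G. \<forall>j \<in> verts G. \<forall>\<alpha> \<in> edges G i j. \<forall>\<alpha>' \<in> edges G i j.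
        (\<Sum>k \<in> verts G. \<Sum>\<beta> \<in> edges G j k. \<Sum>\<gamma> \<in> edges G k i.
           W \<alpha> \<beta> \<gamma> * cnj (W \<alpha>' \<beta> \<gamma>))
        = of_bool (\<alpha> = \<alpha>') * complex_of_real (qint q 2 * \<phi> i * \<phi> j))"

definition type_II ::
    "('v, 'e) pre_digraph \<Rightarrow> ('v \<Rightarrow> real) \<Rightarrow> ('e \<Rightarrow> 'e \<Rightarrow> 'e \<Rightarrow> complex) \<Rightarrow> bool" where
  "type_II G \<phi> W \<longleftrightarrow>
     (\<forall>i1 \<in> verts G. \<forall>i2 \<in> verts G. \<forall>i3 \<in> verts G. \<forall>i4 \<in> verts G.
      \<forall>\<alpha>1 \<in> edges G i1 i2. \<forall>\<alpha>2 \<in> edges G i3 i2. \<forall>\<alpha>3 \<in> edges G i3 i4. \<forall>\<alpha>4 \<in> edges G i1 i4.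
        (\<Sum>k \<in> verts G. \<Sum>\<beta>1 \<in> edges G i2 k. \<Sum>\<beta>2 \<in> edges G k i1.
         \<Sum>\<beta>3 \<in> edges G k i3. \<Sum>\<beta>4 \<in> edges G i4 k.
           complex_of_real (inverse (\<phi> k)) * W \<alpha>1 \<beta>1 \<beta>2 * cnj (W \<alpha>2 \<beta>1 \<beta>3)
             * W \<alpha>3 \<beta>4 \<beta>3 * cnj (W \<alpha>4 \<beta>4 \<beta>2))
        = of_bool (\<alpha>1 = \<alpha>4 \<and> \<alpha>2 = \<alpha>3) * complex_of_real (\<phi> i1 * \<phi> i2 * \<phi> i3)
        + of_bool (\<alpha>1 = \<alpha>2 \<and> \<alpha>3 = \<alpha>4) * complex_of_real (\<phi> i1 * \<phi> i2 * \<phi> i4))"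

definition cell_system ::
    "complex \<Rightarrow> ('v, 'e) pre_digraph \<Rightarrow> ('v \<Rightarrow> real) \<Rightarrow> ('e \<Rightarrow> 'e \<Rightarrow> 'e \<Rightarrow> complex) \<Rightarrow> bool" where
  "cell_system q G \<phi> W \<longleftrightarrow>
     fin_digraph G \<and> PF_eigenvector G (qint q 3) \<phi> \<and>
     rotation_invariant G W \<and> type_I q G \<phi> W \<and> type_II G \<phi> W"

text \<open>
  The unitary matrices, one for each pair of adjacent vertices, are the blocks of a single
  \<open>u :: 'e \<Rightarrow> 'e \<Rightarrow> complex\<close>: an edge determines its endpoints.
\<close>

definition edge_unitary :: "('v, 'e) pre_digraph \<Rightarrow> ('e \<Rightarrow> 'e \<Rightarrow> complex) \<Rightarrow> bool" where
  "edge_unitary G u \<longleftrightarrow>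
     (\<forall>i \<in> verts G. \<forall>j \<in> verts G. \<forall>\<sigma> \<in> edges G i j. \<forall>\<sigma>' \<in> edges G i j.
        (\<Sum>\<tau> \<in> edges G i j. u \<sigma> \<tau> * cnj (u \<sigma>' \<tau>)) = of_bool (\<sigma> = \<sigma>') \<and>
        (\<Sum>\<tau> \<in> edges G i j. cnj (u \<tau> \<sigma>) * u \<tau> \<sigma>') = of_bool (\<sigma> = \<sigma>'))"

definition cell_equivalent ::
    "complex \<Rightarrow> ('v, 'e) pre_digraph \<Rightarrow> ('v \<Rightarrow> real) \<Rightarrow>
     ('e \<Rightarrow> 'e \<Rightarrow> 'e \<Rightarrow> complex) \<Rightarrow> ('e \<Rightarrow> 'e \<Rightarrow> 'e \<Rightarrow> complex) \<Rightarrow> bool" where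
  "cell_equivalent q G \<phi> W1 W2 \<longleftrightarrow>
     cell_system q G \<phi> W1 \<and> cell_system q G \<phi> W2 \<and>
     (\<exists>u. edge_unitary G u \<and>
        (\<forall>i \<in> verts G. \<forall>j \<in> verts G. \<forall>k \<in> verts G.
         \<forall>\<sigma> \<in> edges G i j. \<forall>\<rho> \<in> edges G j k. \<forall>\<gamma> \<in> edges G k i.
           W1 \<sigma> \<rho> \<gamma> =
             (\<Sum>\<sigma>' \<in> edges G i j. \<Sum>\<rho>' \<in> edges G j k. \<Sum>\<gamma>' \<in> edges G k i.
                u \<sigma> \<sigma>' * u \<rho> \<rho>' * u \<gamma> \<gamma>' * W2 \<sigma>' \<rho>' \<gamma>')))"


section \<open>The graph \<open>\<D>\<^sup>(\<^sup>2\<^sup>n\<^sup>+\<^sup>1\<^sup>)\<^sup>*\<close>\<close>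

datatype dvertex = vi nat | vj nat | vk nat

text \<open>The graph has no multiple edges, so an edge is the pair of its endpoints.\<close>

definition Dstar :: "nat \<Rightarrow> (dvertex, dvertex \<times> dvertex) pre_digraph" where
  "Dstar n = (let R = {(l, m). l \<in> {1..n} \<and> m \<in> {1..n} \<and>
                        \<bar>int l - int m\<bar> \<le> 1 \<and> (l, m) \<noteq> (1, 1)} in
     \<lparr> verts = vi ` {1..n} \<union> vj ` {1..n} \<union> vk ` {1..n},
       arcs = (\<lambda>(l, m). (vi l, vj m)) ` R \<union> (\<lambda>(l, m). (vj l, vk m)) ` R
            \<union> (\<lambda>(l, m). (vk l, vi m)) ` R,
       tail = fst, head = snd \<rparr>)"

definition Dstar_q :: "nat \<Rightarrow> complex" where
  "Dstar_q n = exp (complex_of_real pi * \<i> / of_nat (2 * n + 1))"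

fun Dstar_phi :: "nat \<Rightarrow> dvertex \<Rightarrow> real" where
  "Dstar_phi n (vi l) = qint (Dstar_q n) (2 * l - 1)"
| "Dstar_phi n (vj l) = qint (Dstar_q n) (2 * l - 1)"
| "Dstar_phi n (vk l) = qint (Dstar_q n) (2 * l - 1)"

abbreviation Dstar_cell_system ::
    "nat \<Rightarrow> (dvertex \<times> dvertex \<Rightarrow> dvertex \<times> dvertex \<Rightarrow> dvertex \<times> dvertex \<Rightarrow> complex) \<Rightarrow> bool" where
  "Dstar_cell_system n \<equiv> cell_system (Dstar_q n) (Dstar n) (Dstar_phi n)"

abbreviation Dstar_equivalent ::
    "nat \<Rightarrow> (dvertex \<times> dvertex \<Rightarrow> dvertex \<times> dvertex \<Rightarrow> dvertex \<times> dvertex \<Rightarrow> complex) \<Rightarrow>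
     (dvertex \<times> dvertex \<Rightarrow> dvertex \<times> dvertex \<Rightarrow> dvertex \<times> dvertex \<Rightarrow> complex) \<Rightarrow> bool" where
  "Dstar_equivalent n \<equiv> cell_equivalent (Dstar_q n) (Dstar n) (Dstar_phi n)"

definition cell_at :: "('v \<times> 'v \<Rightarrow> 'v \<times> 'v \<Rightarrow> 'v \<times> 'v \<Rightarrow> complex) \<Rightarrow> 'v \<Rightarrow> 'v \<Rightarrow> 'v \<Rightarrow> complex" where
  "cell_at W a b c = W (a, b) (b, c) (c, a)"

definition Z3_symmetric_solution ::
    "nat \<Rightarrow> (dvertex \<times> dvertex \<Rightarrow> dvertex \<times> dvertex \<Rightarrow> dvertex \<times> dvertex \<Rightarrow> complex) \<Rightarrow> bool" where
  "Z3_symmetric_solution n W \<longleftrightarrow> Dstar_cell_system n W \<and>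
     (\<forall>p q r. triangle (Dstar n) (vi p, vj q) (vj q, vk r) (vk r, vi p) \<longrightarrow>
        cmod (cell_at W (vi p) (vj q) (vk r)) = cmod (cell_at W (vi q) (vj r) (vk p)) \<and>
        cmod (cell_at W (vi q) (vj r) (vk p)) = cmod (cell_at W (vi r) (vj p) (vk q)))"

text \<open>
  The value on the triangle \<open>i\<^sub>a \<rightarrow> j\<^sub>b \<rightarrow> k\<^sub>c \<rightarrow> i\<^sub>a\<close>. The levels of
  a triangle lie in \<open>{l, l + 1}\<close> with \<open>l\<close> the least of them; if \<open>l = 1\<close> then the other two
  levels are \<open>2\<close>, so the last two formulas are only used for \<open>l \<ge> 2\<close>.
\<close>

definition Dstar_value :: "nat \<Rightarrow> nat \<Rightarrow> nat \<Rightarrow> nat \<Rightarrow> real" where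
  "Dstar_value n a b c =
     (let N = qint (Dstar_q n); l = min a (min b c) in
      if (a, b, c) \<in> {(1, 2, 2), (2, 1, 2), (2, 2, 1)}
        then sqrt (N 2 * N 3)
      else if (a, b, c) \<in> {(l, l+1, l+1), (l+1, l, l+1), (l+1, l+1, l)}
        then sqrt (N (l+1) * N (2*l-1) * N (2*l+1)) / sqrt (N l)
      else if (a, b, c) \<in> {(l, l, l+1), (l, l+1, l), (l+1, l, l)}
        then sqrt (N (l-1) * N (2*l-1) * N (2*l+1)) / sqrt (N l)
      else if (a, b, c) = (l, l, l)
        then (-1) ^ (l+1) * N (2*l-1) / sqrt (N (l-1) * N l)
      else 0)"

text \<open>The three equations are the three rotations of one triangle.\<close>

fun Dstar_solution ::
    "nat \<Rightarrow> dvertex \<times> dvertex \<Rightarrow> dvertex \<times> dvertex \<Rightarrow> dvertex \<times> dvertex \<Rightarrow> complex" where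
  "Dstar_solution n (vi a, _) (vj b, _) (vk c, _) = complex_of_real (Dstar_value n a b c)"
| "Dstar_solution n (vj b, _) (vk c, _) (vi a, _) = complex_of_real (Dstar_value n a b c)"
| "Dstar_solution n (vk c, _) (vi a, _) (vj b, _) = complex_of_real (Dstar_value n a b c)"
| "Dstar_solution n _ _ _ = 0"

lemma Dstar_solution_table:
  fixes n l :: nat
  defines "N \<equiv> qint (Dstar_q n)" and "W \<equiv> (\<lambda>a b c. cell_at (Dstar_solution n) (vi a) (vj b) (vk c))"
  shows "W 1 2 2 = sqrt (N 2 * N 3)" "W 2 1 2 = sqrt (N 2 * N 3)" "W 2 2 1 = sqrt (N 2 * N 3)"
    and "2 \<le> l \<Longrightarrow> W l (l+1) (l+1) = sqrt (N (l+1) * N (2*l-1) * N (2*l+1)) / sqrt (N l)"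
    and "2 \<le> l \<Longrightarrow> W (l+1) l (l+1) = sqrt (N (l+1) * N (2*l-1) * N (2*l+1)) / sqrt (N l)"
    and "2 \<le> l \<Longrightarrow> W (l+1) (l+1) l = sqrt (N (l+1) * N (2*l-1) * N (2*l+1)) / sqrt (N l)"
    and "2 \<le> l \<Longrightarrow> W l l (l+1) = sqrt (N (l-1) * N (2*l-1) * N (2*l+1)) / sqrt (N l)"
    and "2 \<le> l \<Longrightarrow> W l (l+1) l = sqrt (N (l-1) * N (2*l-1) * N (2*l+1)) / sqrt (N l)"
    and "2 \<le> l \<Longrightarrow> W (l+1) l l = sqrt (N (l-1) * N (2*l-1) * N (2*l+1)) / sqrt (N l)"
    and "2 \<le> l \<Longrightarrow> W l l l = (-1) ^ (l+1) * N (2*l-1) / sqrt (N (l-1) * N l)"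
  by (simp_all add: N_def W_def cell_at_def Dstar_value_def Let_def)

end

theory Submission
  imports Defs
begin

text \<open>
  There are no multiple edges, so a triangle is given by its three levels \<open>(a, b, c)\<close>, which all lie
  in some \<open>{l, l + 1}\<close>, and the cell equations become sums over the third level.
  
  The equations in which only squared absolute values occur determine these values. Write
  \<open>A\<^sub>l\<close>, \<open>B\<^sub>l\<close>, \<open>C\<^sub>l\<close> for the squared absolute values on \<open>(l, l+1, l+1)\<close>, \<open>(l, l, l+1)\<close>,
  \<open>(l, l, l)\<close>; by the symmetry they do not depend on the order of the levels. A type I equation at
  the first level gives \<open>A\<^sub>1 = [2][3]\<close>. The type II equation whose four corners have levels
  \<open>l, l-1, l, l+1\<close> has a single summand and gives the product \<open>A\<^sub>l\<^sub>-\<^sub>1 B\<^sub>l\<close>, hence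
  \<open>B\<^sub>l\<close>; the type I equation on the edge from \<open>l\<close> to \<open>l+1\<close> then gives \<open>A\<^sub>l\<close>, and the one on the edge from
  \<open>l\<close> to \<open>l\<close> gives \<open>C\<^sub>l\<close>. This linear recursion has only one solution (\<open>cell_moduli\<close>),
  and on triangles none of its values is zero.
  
  What remains is a phase \<open>r a b c\<close> on each triangle. The only equations that see it are the type II
  equations at \<open>l, l, l+1, l+1\<close>: a sum of two terms of equal absolute value vanishes, which says
  exactly that \<open>r\<close> satisfies one multiplicative relation on the cube \<open>{l, l+1}\<^sup>3\<close>
  (\<open>phase_cocycle\<close>). This relation is what is needed to write \<open>r a b c = f a b * g b c * h c a\<close>
  (\<open>gauge_decomposition\<close>), and since the unitary matrices of an equivalence are
  just phases on the edges, \<open>f\<close>, \<open>g\<close>, \<open>h\<close> constitute an equivalence.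
  
  That the explicit values do satisfy the equations reduces, through
  \<open>[l-1][l+1] = [l]\<^sup>2 - 1\<close> and \<open>[2l-1] = [l]\<^sup>2 - [l-1]\<^sup>2\<close>, to polynomial identities in
  \<open>[l-1]\<close>, \<open>[l]\<close>, \<open>[l+1]\<close>. No special identities are needed at the ends of the graph, because the
  general formulas vanish there: \<open>[0] = 0\<close> and \<open>[2n+1] = 0\<close>.
\<close>

section \<open>Quantum integers at a root of unity\<close>

lemma Dstar_qint_sin:
  "qint (Dstar_q n) m = sin (real m * (pi / (2 * n + 1))) / sin (pi / (2 * n + 1))"
proof -
  define t where "t = pi / (2 * n + 1)"
  have q: "Dstar_q n = cis t"
    by (simp add: Dstar_q_def t_def cis_conv_exp mult.commute)
  have "cis t ^ m - inverse (cis t) ^ m = 2 * \<i> * of_real (sin (real m * t))"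
    by (simp add: DeMoivre complex_eq_iff)
  moreover have "cis t - inverse (cis t) = 2 * \<i> * of_real (sin t)"
    by (simp add: complex_eq_iff)
  ultimately have "(cis t ^ m - inverse (cis t) ^ m) / (cis t - inverse (cis t))
      = of_real (sin (real m * t) / sin t)"
    by simp
  then show ?thesis
    by (simp add: qint_def q t_def)
qed

context
  fixes n :: nat
  assumes n2: "2 \<le> n"
begin

abbreviation N :: "nat \<Rightarrow> real" where "N \<equiv> qint (Dstar_q n)"

lemma sin_angle_pos: "1 \<le> m \<Longrightarrow> m \<le> 2 * n \<Longrightarrow> 0 < sin (real m * (pi / (2 * n + 1)))"
  by (rule sin_gt_zero) (auto simp: divide_simps)

lemma sin_angle_1: "0 < sin (pi / (2 * n + 1))"
  using sin_angle_pos[of 1] n2 by simp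

lemma qint_pos: "1 \<le> m \<Longrightarrow> m \<le> 2 * n \<Longrightarrow> 0 < N m"
  using sin_angle_pos[of m] sin_angle_1 by (simp add: Dstar_qint_sin)

lemma qint_0: "N 0 = 0"
  by (simp add: Dstar_qint_sin)

lemma qint_1: "N (Suc 0) = 1"
  using sin_angle_1 by (simp add: Dstar_qint_sin)

text \<open>
  The choice of the root of unity enters here: this is the boundary condition at level \<open>n\<close>.
\<close>

lemma qint_top: "N (Suc (2 * n)) = 0"
proof -
  have "real (Suc (2 * n)) * (pi / (2 * n + 1)) = pi" by (simp add: field_simps)
  then show ?thesis unfolding Dstar_qint_sin by simp
qed

lemma qint_rec: "N (Suc (Suc m)) = N 2 * N (Suc m) - N m"
proof -
  define t where "t = pi / (2 * n + 1)"
  have "sin (real (Suc (Suc m)) * t) + sin (real m * t) = 2 * cos t * sin (real (Suc m) * t)"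
    using sin_add[of "real (Suc m) * t" t] sin_diff[of "real (Suc m) * t" t]
    by (simp add: algebra_simps)
  moreover have "sin (2 * t) = 2 * cos t * sin t" by (simp add: sin_double)
  moreover have "sin t \<noteq> 0" using sin_angle_1 t_def by simp
  ultimately show ?thesis
    unfolding Dstar_qint_sin t_def[symmetric] by (simp add: field_simps)
qed

text \<open>
  The quantum integers solve a second order recursion with determinant one; its Wronskian is
  constant.
\<close>

lemma qint_det: "N m * N (Suc (Suc m)) = (N (Suc m))\<^sup>2 - 1"
proof (induction m)
  case 0
  then show ?case by (simp add: qint_0 qint_1)
next
  case (Suc m)
  then show ?case
    using qint_rec[of m] qint_rec[of "Suc m"] by algebra
qed

text \<open>
  This turns the Perron-Frobenius weights \<open>[2m+1]\<close> into polynomials in the quantum integers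
  that occur in the cells; it is
  \<open>sin (x + y) * sin (x - y) = sin\<^sup>2 x - sin\<^sup>2 y\<close>.
\<close>

lemma qint_odd: "N (Suc (2 * m)) = (N (Suc m))\<^sup>2 - (N m)\<^sup>2"
proof -
  define t where "t = pi / (2 * n + 1)"
  have a: "real (Suc (2 * m)) * t = real (Suc m) * t + real m * t"
    and b: "t = real (Suc m) * t - real m * t" by (simp_all add: algebra_simps)
  have "sin (real (Suc (2 * m)) * t) * sin t
      = (sin (real (Suc m) * t))\<^sup>2 * (cos (real m * t))\<^sup>2
        - (cos (real (Suc m) * t))\<^sup>2 * (sin (real m * t))\<^sup>2"
    by (subst (2) b, unfold a sin_add sin_diff) (simp add: algebra_simps power2_eq_square)
  also have "\<dots> = (sin (real (Suc m) * t))\<^sup>2 - (sin (real m * t))\<^sup>2"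
    unfolding cos_squared_eq by (simp add: algebra_simps)
  finally have "sin (real (Suc (2 * m)) * t) * sin t
      = (sin (real (Suc m) * t))\<^sup>2 - (sin (real m * t))\<^sup>2" .
  moreover have "sin t \<noteq> 0" using sin_angle_1 t_def by simp
  ultimately show ?thesis
    unfolding Dstar_qint_sin t_def[symmetric] by (simp add: field_simps power2_eq_square)
qed

lemma qint_3: "N 3 = (N 2)\<^sup>2 - 1"
  using qint_odd[of 1] by (simp add: qint_1 numeral_eq_Suc)

section \<open>The graph in terms of levels\<close>

definition adj :: "nat \<Rightarrow> nat \<Rightarrow> bool" where
  "adj a b \<longleftrightarrow> 1 \<le> a \<and> 1 \<le> b \<and> a \<le> n \<and> b \<le> n \<and> a \<le> Suc b \<and> b \<le> Suc a \<and> (2 \<le> a \<or> 2 \<le> b)"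

definition weight :: "nat \<Rightarrow> real" where
  "weight a = N (2 * a - 1)"

text \<open>
  The three kinds of vertices play the same role up to cyclic rotation, so statements about the
  graph are made for \<open>(X, Y, Z)\<close> any rotation of the three vertex constructors.
\<close>

definition colouring :: "(nat \<Rightarrow> dvertex) \<Rightarrow> (nat \<Rightarrow> dvertex) \<Rightarrow> (nat \<Rightarrow> dvertex) \<Rightarrow> bool" where
  "colouring X Y Z \<longleftrightarrow> (X, Y, Z) \<in> {(vi, vj, vk), (vj, vk, vi), (vk, vi, vj)}"

lemma adj_sym: "adj a b = adj b a"
  by (auto simp: adj_def)

lemma adj_range: "adj a b \<Longrightarrow> a \<in> {1..n}" "adj a b \<Longrightarrow> b \<in> {1..n}"
  by (auto simp: adj_def)

lemma edges_Dstar: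
  assumes "colouring X Y Z"
  shows "edges (Dstar n) (X a) (Y b) = (if adj a b then {(X a, Y b)} else {})"
    and "edges (Dstar n) (X a) (X b) = {}"
    and "edges (Dstar n) (X a) (Z b) = {}"
  using assms
  by (auto simp: colouring_def edges_def Dstar_def adj_def Let_def image_iff)

lemma colouring_rotate: "colouring X Y Z \<Longrightarrow> colouring Y Z X"
  by (auto simp: colouring_def)

lemma verts_Dstar:
  assumes "colouring X Y Z"
  shows "verts (Dstar n) = X ` {1..n} \<union> (Y ` {1..n} \<union> Z ` {1..n})"
  using assms by (auto simp: colouring_def Dstar_def Let_def)

lemma sum_verts_Dstar:
  fixes F :: "dvertex \<Rightarrow> complex"
  assumes "colouring X Y Z"
  shows "(\<Sum>v\<in>verts (Dstar n). F v)
    = (\<Sum>a\<in>{1..n}. F (X a)) + (\<Sum>a\<in>{1..n}. F (Y a)) + (\<Sum>a\<in>{1..n}. F (Z a))"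
proof -
  have "inj X" "inj Y" "inj Z" "\<And>a b. X a \<noteq> Y b" "\<And>a b. X a \<noteq> Z b" "\<And>a b. Y a \<noteq> Z b"
    using assms by (auto simp: colouring_def inj_def)
  then have "X ` A \<inter> (Y ` A \<union> Z ` A) = {}" "Y ` A \<inter> Z ` A = {}" "inj_on X A" "inj_on Y A" "inj_on Z A"
    for A by (auto simp: inj_on_def inj_def)
  then show ?thesis
    by (simp add: verts_Dstar[OF assms] sum.union_disjoint sum.reindex)
qed

lemma Dstar_arcE:
  assumes "e \<in> arcs (Dstar n)"
  obtains X Y Z a b where "colouring X Y Z" "adj a b" "e = (X a, Y b)"
proof -
  have "\<exists>a b. adj a b \<and> (e = (vi a, vj b) \<or> e = (vj a, vk b) \<or> e = (vk a, vi b))"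
    using assms unfolding Dstar_def Let_def adj_def by auto
  then show thesis
    using that[of vi vj vk] that[of vj vk vi] that[of vk vi vj] by (auto simp: colouring_def)
qed

lemma sum_if_level:
  fixes F :: "nat \<Rightarrow> complex"
  assumes "\<And>c. P c \<Longrightarrow> c \<in> {1..n}"
  shows "(\<Sum>c\<in>{1..n}. if P c then F c else 0) = (\<Sum>c | P c. F c)"
  using assms by (subst sum.inter_filter[symmetric]) (auto intro!: sum.cong)

text \<open>
  The cell equations for the values \<open>w a b c\<close> on one colouring, with the sum over vertices replaced by
  the sum over those levels for which all triangles in the summand exist.
\<close>

definition level_I :: "(nat \<Rightarrow> nat \<Rightarrow> nat \<Rightarrow> complex) \<Rightarrow> bool" where
  "level_I w \<longleftrightarrow> (\<forall>a b. adj a b \<longrightarrow>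
     (\<Sum>c | adj b c \<and> adj c a. w a b c * cnj (w a b c)) = of_real (N 2 * weight a * weight b))"

definition level_II :: "(nat \<Rightarrow> nat \<Rightarrow> nat \<Rightarrow> complex) \<Rightarrow> bool" where
  "level_II w \<longleftrightarrow> (\<forall>a b a' b'. adj a b \<longrightarrow> adj a' b \<longrightarrow> adj a' b' \<longrightarrow> adj a b' \<longrightarrow>
     (\<Sum>c | adj b c \<and> adj c a \<and> adj c a' \<and> adj b' c.
        of_real (inverse (weight c)) * w a b c * cnj (w a' b c) * w a' b' c * cnj (w a b' c))
     = of_bool (b = b') * of_real (weight a * weight b * weight a')
     + of_bool (a = a') * of_real (weight a * weight b * weight b'))"

lemma Dstar_phi_colouring: "colouring X Y Z \<Longrightarrow> Dstar_phi n (X a) = weight a"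
  by (auto simp: colouring_def weight_def)

lemma colouring_inj: "colouring X Y Z \<Longrightarrow> X a = X b \<longleftrightarrow> a = b"
  by (auto simp: colouring_def)

text \<open>
  Both edges of a summand must exist, and then each is unique, so only vertices of the third colour at
  admissible levels contribute.
\<close>

lemma type_I_term:
  assumes c: "colouring X Y Z" and ab: "adj a b"
  shows "(\<Sum>k \<in> verts (Dstar n). \<Sum>\<beta> \<in> edges (Dstar n) (Y b) k. \<Sum>\<gamma> \<in> edges (Dstar n) k (X a). F k \<beta> \<gamma>)
    = (\<Sum>d | adj b d \<and> adj d a. F (Z d) (Y b, Z d) (Z d, X a) :: complex)"
proof -
  note c2 = colouring_rotate[OF c] note c3 = colouring_rotate[OF c2]
  have "(\<Sum>k \<in> verts (Dstar n). \<Sum>\<beta> \<in> edges (Dstar n) (Y b) k. \<Sum>\<gamma> \<in> edges (Dstar n) k (X a). F k \<beta> \<gamma>)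
    = (\<Sum>d\<in>{1..n}. if adj b d \<and> adj d a then F (Z d) (Y b, Z d) (Z d, X a) else 0)"
    unfolding sum_verts_Dstar[OF c]
    by (auto simp: edges_Dstar[OF c] edges_Dstar[OF c2] edges_Dstar[OF c3] intro!: sum.cong)
  also have "\<dots> = (\<Sum>d | adj b d \<and> adj d a. F (Z d) (Y b, Z d) (Z d, X a))"
    by (rule sum_if_level) (auto simp: adj_def)
  finally show ?thesis .
qed

lemma type_II_term:
  assumes c: "colouring X Y Z" 
  shows "(\<Sum>k \<in> verts (Dstar n). \<Sum>\<beta>1 \<in> edges (Dstar n) (Y b) k. \<Sum>\<beta>2 \<in> edges (Dstar n) k (X a).
       \<Sum>\<beta>3 \<in> edges (Dstar n) k (X a'). \<Sum>\<beta>4 \<in> edges (Dstar n) (Y b') k. F k \<beta>1 \<beta>2 \<beta>3 \<beta>4)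
    = (\<Sum>d | adj b d \<and> adj d a \<and> adj d a' \<and> adj b' d.
         F (Z d) (Y b, Z d) (Z d, X a) (Z d, X a') (Y b', Z d) :: complex)"
proof -
  note c2 = colouring_rotate[OF c] note c3 = colouring_rotate[OF c2]
  have "(\<Sum>k \<in> verts (Dstar n). \<Sum>\<beta>1 \<in> edges (Dstar n) (Y b) k. \<Sum>\<beta>2 \<in> edges (Dstar n) k (X a).
       \<Sum>\<beta>3 \<in> edges (Dstar n) k (X a'). \<Sum>\<beta>4 \<in> edges (Dstar n) (Y b') k. F k \<beta>1 \<beta>2 \<beta>3 \<beta>4)
    = (\<Sum>d\<in>{1..n}. if adj b d \<and> adj d a \<and> adj d a' \<and> adj b' d then
         F (Z d) (Y b, Z d) (Z d, X a) (Z d, X a') (Y b', Z d) else 0)"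
    unfolding sum_verts_Dstar[OF c]
    by (auto simp: edges_Dstar[OF c] edges_Dstar[OF c2] edges_Dstar[OF c3] intro!: sum.cong)
  also have "\<dots> = (\<Sum>d | adj b d \<and> adj d a \<and> adj d a' \<and> adj b' d.
         F (Z d) (Y b, Z d) (Z d, X a) (Z d, X a') (Y b', Z d))"
    by (rule sum_if_level) (auto simp: adj_def)
  finally show ?thesis .
qed

lemma Dstar_edgeE:
  assumes "e \<in> edges (Dstar n) s t"
  obtains X Y Z a b where "colouring X Y Z" "adj a b" "e = (X a, Y b)" "s = X a" "t = Y b"
proof -
  have "e \<in> arcs (Dstar n)" "s = fst e" "t = snd e"
    using assms by (auto simp: edges_def Dstar_def Let_def)
  then show ?thesis using that Dstar_arcE by (metis fst_conv snd_conv)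
qed

lemma Dstar_vertE:
  assumes "v \<in> verts (Dstar n)" "colouring X Y Z"
  obtains a where "v = X a" | a where "v = Y a" | a where "v = Z a"
  using assms verts_Dstar[OF assms(2)] by blast

lemma colouring_in_verts:
  assumes "colouring X Y Z" "a \<in> {1..n}"
  shows "X a \<in> verts (Dstar n)" "Y a \<in> verts (Dstar n)" "Z a \<in> verts (Dstar n)"
  using assms verts_Dstar[OF assms(1)] by blast+

lemma type_I_levels:
  "type_I (Dstar_q n) (Dstar n) (Dstar_phi n) W \<longleftrightarrow>
     (\<forall>X Y Z. colouring X Y Z \<longrightarrow> level_I (\<lambda>a b c. cell_at W (X a) (Y b) (Z c)))"
proof (intro iffI allI impI)
  fix X Y Z
  assume W: "type_I (Dstar_q n) (Dstar n) (Dstar_phi n) W" and c: "colouring X Y Z"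
  show "level_I (\<lambda>a b c. cell_at W (X a) (Y b) (Z c))"
    unfolding level_I_def
  proof (intro allI impI)
    fix a b assume ab: "adj a b"
    then have e: "(X a, Y b) \<in> edges (Dstar n) (X a) (Y b)" by (simp add: edges_Dstar[OF c])
    have "X a \<in> verts (Dstar n)" "Y b \<in> verts (Dstar n)"
      using colouring_in_verts[OF c] adj_range[OF ab] by auto
    from W[unfolded type_I_def, rule_format, OF this e e]
    show "(\<Sum>d | adj b d \<and> adj d a. cell_at W (X a) (Y b) (Z d) * cnj (cell_at W (X a) (Y b) (Z d)))
        = of_real (N 2 * weight a * weight b)"
      unfolding type_I_term[OF c ab] Dstar_phi_colouring[OF c] Dstar_phi_colouring[OF colouring_rotate[OF c]]
      by (simp add: cell_at_def)
  qed
next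
  assume W: "\<forall>X Y Z. colouring X Y Z \<longrightarrow> level_I (\<lambda>a b c. cell_at W (X a) (Y b) (Z c))"
  show "type_I (Dstar_q n) (Dstar n) (Dstar_phi n) W"
    unfolding type_I_def
  proof (intro ballI)
    fix s t e e'
    assume e: "e \<in> edges (Dstar n) s t" and e': "e' \<in> edges (Dstar n) s t"
    from e obtain X Y Z a b where *: "colouring X Y Z" "adj a b" "e = (X a, Y b)" "s = X a" "t = Y b"
      by (rule Dstar_edgeE)
    with e' have "e' = e" by (simp add: edges_Dstar[OF *(1)])
    then show "(\<Sum>k \<in> verts (Dstar n). \<Sum>\<beta> \<in> edges (Dstar n) t k. \<Sum>\<gamma> \<in> edges (Dstar n) k s.
          W e \<beta> \<gamma> * cnj (W e' \<beta> \<gamma>))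
        = of_bool (e = e') * complex_of_real (N 2 * Dstar_phi n s * Dstar_phi n t)"
      using W[rule_format, OF *(1), unfolded level_I_def, rule_format, OF *(2)]
      unfolding *(4,5) type_I_term[OF *(1,2)] Dstar_phi_colouring[OF *(1)]
        Dstar_phi_colouring[OF colouring_rotate[OF *(1)]]
      by (simp add: cell_at_def *(3))
  qed
qed

text \<open>
  The vertices \<open>i\<^sub>1\<close> and \<open>i\<^sub>3\<close> both have an edge to \<open>i\<^sub>2\<close>, and \<open>i\<^sub>4\<close> receives an edge from \<open>i\<^sub>1\<close>; so
  the colour of \<open>i\<^sub>1\<close> determines those of the other three, and the equation is one about levels.
\<close>

lemma type_II_levels:
  "type_II (Dstar n) (Dstar_phi n) W \<longleftrightarrow>
     (\<forall>X Y Z. colouring X Y Z \<longrightarrow> level_II (\<lambda>a b c. cell_at W (X a) (Y b) (Z c)))"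
proof (intro iffI allI impI)
  fix X Y Z
  assume W: "type_II (Dstar n) (Dstar_phi n) W" and c: "colouring X Y Z"
  show "level_II (\<lambda>a b c. cell_at W (X a) (Y b) (Z c))"
    unfolding level_II_def
  proof (intro allI impI)
    fix a b a' b' assume ab: "adj a b" "adj a' b" "adj a' b'" "adj a b'"
    then have e: "(X a, Y b) \<in> edges (Dstar n) (X a) (Y b)" "(X a', Y b) \<in> edges (Dstar n) (X a') (Y b)"
      "(X a', Y b') \<in> edges (Dstar n) (X a') (Y b')" "(X a, Y b') \<in> edges (Dstar n) (X a) (Y b')"
      by (simp_all add: edges_Dstar[OF c])
    have "X a \<in> verts (Dstar n)" "Y b \<in> verts (Dstar n)" "X a' \<in> verts (Dstar n)" "Y b' \<in> verts (Dstar n)"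
      using colouring_in_verts[OF c] ab[THEN adj_range(1)] ab[THEN adj_range(2)] by auto
    from W[unfolded type_II_def, rule_format, OF this e]
    show "(\<Sum>d | adj b d \<and> adj d a \<and> adj d a' \<and> adj b' d.
          of_real (inverse (weight d)) * cell_at W (X a) (Y b) (Z d) * cnj (cell_at W (X a') (Y b) (Z d))
           * cell_at W (X a') (Y b') (Z d) * cnj (cell_at W (X a) (Y b') (Z d)))
     = of_bool (b = b') * of_real (weight a * weight b * weight a')
     + of_bool (a = a') * of_real (weight a * weight b * weight b')"
      unfolding type_II_term[OF c] Dstar_phi_colouring[OF c] Dstar_phi_colouring[OF colouring_rotate[OF c]]
        Dstar_phi_colouring[OF colouring_rotate[OF colouring_rotate[OF c]]]
      by (simp add: cell_at_def colouring_inj[OF c] colouring_inj[OF colouring_rotate[OF c]])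
  qed
next
  assume W: "\<forall>X Y Z. colouring X Y Z \<longrightarrow> level_II (\<lambda>a b c. cell_at W (X a) (Y b) (Z c))"
  show "type_II (Dstar n) (Dstar_phi n) W"
    unfolding type_II_def
  proof (intro ballI)
    fix s t s' t' e1 e2 e3 e4
    assume v: "s' \<in> verts (Dstar n)" "t' \<in> verts (Dstar n)"
      and e: "e1 \<in> edges (Dstar n) s t" "e2 \<in> edges (Dstar n) s' t"
      "e3 \<in> edges (Dstar n) s' t'" "e4 \<in> edges (Dstar n) s t'"
    from e(1) obtain X Y Z a b where *: "colouring X Y Z" "adj a b" "e1 = (X a, Y b)" "s = X a" "t = Y b"
      by (rule Dstar_edgeE)
    note c = *(1) note c2 = colouring_rotate[OF c] note c3 = colouring_rotate[OF c2]
    obtain a' where s': "s' = X a'"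
      using e(2) by (cases rule: Dstar_vertE[OF v(1) c]) (simp_all add: *(5) edges_Dstar[OF c2] edges_Dstar[OF c3])
    obtain b' where t': "t' = Y b'"
      using e(4) by (cases rule: Dstar_vertE[OF v(2) c]) (simp_all add: *(4) edges_Dstar[OF c])
    have "adj a' b \<and> e2 = (X a', Y b)" "adj a' b' \<and> e3 = (X a', Y b')" "adj a b' \<and> e4 = (X a, Y b')"
      using e unfolding *(4,5) s' t' edges_Dstar[OF c] by (auto split: if_splits)
    then have ab: "adj a' b" "adj a' b'" "adj a b'"
      and ee: "e2 = (X a', Y b)" "e3 = (X a', Y b')" "e4 = (X a, Y b')" by auto
    have "(e1 = e4 \<and> e2 = e3) \<longleftrightarrow> b = b'" "(e1 = e2 \<and> e3 = e4) \<longleftrightarrow> a = a'"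
      using colouring_inj[OF c] colouring_inj[OF c2] unfolding *(3) ee by auto
    then show "(\<Sum>k \<in> verts (Dstar n). \<Sum>\<beta>1 \<in> edges (Dstar n) t k. \<Sum>\<beta>2 \<in> edges (Dstar n) k s.
         \<Sum>\<beta>3 \<in> edges (Dstar n) k s'. \<Sum>\<beta>4 \<in> edges (Dstar n) t' k.
           complex_of_real (inverse (Dstar_phi n k)) * W e1 \<beta>1 \<beta>2 * cnj (W e2 \<beta>1 \<beta>3)
             * W e3 \<beta>4 \<beta>3 * cnj (W e4 \<beta>4 \<beta>2))
        = of_bool (e1 = e4 \<and> e2 = e3) * complex_of_real (Dstar_phi n s * Dstar_phi n t * Dstar_phi n s')
        + of_bool (e1 = e2 \<and> e3 = e4) * complex_of_real (Dstar_phi n s * Dstar_phi n t * Dstar_phi n t')"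
      using W[rule_format, OF c, unfolded level_II_def, rule_format, OF *(2) ab]
      unfolding cell_at_def *(3,4,5) ee s' t' type_II_term[OF c] Dstar_phi_colouring[OF c] Dstar_phi_colouring[OF c2]
        Dstar_phi_colouring[OF c3]
      by (simp only:)
  qed
qed

section \<open>The explicit solution on levels\<close>

lemma weight_Suc: "weight (Suc p) = (N (Suc p))\<^sup>2 - (N p)\<^sup>2"
  by (simp add: weight_def qint_odd)

lemma weight_1: "weight (Suc 0) = 1"
  by (simp add: weight_def qint_1)

lemma weight_top: "weight (Suc n) = 0"
  by (simp add: weight_def qint_top)

lemma weight_pos: "1 \<le> a \<Longrightarrow> a \<le> n \<Longrightarrow> 0 < weight a"
  unfolding weight_def by (rule qint_pos) auto

lemma weight_nonneg: "1 \<le> a \<Longrightarrow> a \<le> Suc n \<Longrightarrow> 0 \<le> weight a"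
  using weight_pos[of a] weight_top by (cases "a = Suc n") auto

text \<open>
  The values of the solution on triangles with levels \<open>l, l+1, l+1\<close>, with levels \<open>l, l, l+1\<close> and with all
  levels \<open>l\<close>.
\<close>

definition alpha :: "nat \<Rightarrow> real" where
  "alpha l = sqrt (N (Suc l) * weight l * weight (Suc l)) / sqrt (N l)"

definition beta :: "nat \<Rightarrow> real" where
  "beta l = sqrt (N (l - 1) * weight l * weight (Suc l)) / sqrt (N l)"

definition gam :: "nat \<Rightarrow> real" where
  "gam l = (-1) ^ (l + 1) * weight l / sqrt (N (l - 1) * N l)"

abbreviation V :: "nat \<Rightarrow> nat \<Rightarrow> nat \<Rightarrow> real" where "V \<equiv> Dstar_value n"

text \<open>
  At \<open>l = 1\<close> the entry \<open>sqrt ([2][3])\<close> of the table is the general formula with \<open>[1] = 1\<close>. The other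
  two formulas vanish at \<open>l = 1\<close>, where there is no triangle, because they contain \<open>[0] = 0\<close> and because
  division by zero yields zero. Thus \<open>l = 1\<close> is no exception.
\<close>

lemma V_level:
  assumes "1 \<le> l"
  shows "V l l l = gam l"
    "V l l (Suc l) = beta l" "V l (Suc l) l = beta l" "V (Suc l) l l = beta l"
    "V l (Suc l) (Suc l) = alpha l" "V (Suc l) l (Suc l) = alpha l" "V (Suc l) (Suc l) l = alpha l"
  using assms
  by (auto simp: Dstar_value_def Let_def weight_def alpha_def beta_def gam_def numeral_eq_Suc qint_1)

lemma V_rotate: "V a b c = V b c a"
proof -
  have m: "min b (min c a) = min a (min b c)"
    by (simp add: min.commute min.left_commute)
  have "(b, c, a) \<in> {(x, y, y), (y, x, y), (y, y, x)} \<longleftrightarrow> (a, b, c) \<in> {(x, y, y), (y, x, y), (y, y, x)}"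
    "(b, c, a) \<in> {(x, x, y), (x, y, x), (y, x, x)} \<longleftrightarrow> (a, b, c) \<in> {(x, x, y), (x, y, x), (y, x, x)}"
    "(b, c, a) = (x, x, x) \<longleftrightarrow> (a, b, c) = (x, x, x)" for x y
    by blast+
  then show ?thesis unfolding Dstar_value_def Let_def m by (simp only:)
qed

lemma alpha_sq: "1 \<le> l \<Longrightarrow> l \<le> n \<Longrightarrow> (alpha l)\<^sup>2 = N (Suc l) * weight l * weight (Suc l) / N l"
  using n2 qint_pos[of l] qint_pos[of "Suc l"] weight_nonneg[of l] weight_nonneg[of "Suc l"]
  by (simp add: alpha_def power_divide)

lemma beta_sq: "1 \<le> p \<Longrightarrow> p < n \<Longrightarrow>
    (beta (Suc p))\<^sup>2 = N p * weight (Suc p) * weight (Suc (Suc p)) / N (Suc p)"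
  using n2 qint_pos[of p] qint_pos[of "Suc p"] weight_nonneg[of "Suc p"] weight_nonneg[of "Suc (Suc p)"]
  by (simp add: beta_def power_divide)

lemma gam_sq: "1 \<le> p \<Longrightarrow> p < n \<Longrightarrow> (gam (Suc p))\<^sup>2 = (weight (Suc p))\<^sup>2 / (N p * N (Suc p))"
  using qint_pos[of p] qint_pos[of "Suc p"]
  by (simp add: gam_def power_divide power_mult_distrib flip: power_mult)

lemma beta_1: "beta (Suc 0) = 0"
  by (simp add: beta_def qint_0)

lemma beta_top: "beta n = 0"
  by (simp add: beta_def weight_top)

text \<open>
  The type I equation on an edge between consecutive levels: it is the recursion
  \<open>[l+1] + [l-1] = [2][l]\<close>.
\<close>

lemma alpha_beta_sum:
  assumes "1 \<le> l" "l \<le> n"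
  shows "(beta l)\<^sup>2 + (alpha l)\<^sup>2 = N 2 * weight l * weight (Suc l)"
proof (cases "l = 1")
  case True
  then show ?thesis using alpha_sq[of 1] n2 by (simp add: beta_1 qint_1 weight_1 numeral_2_eq_2)
next
  case False
  then obtain p where l: "l = Suc p" "1 \<le> p" using assms by (cases l) auto
  have "N l > 0" using qint_pos[of l] assms by auto
  then show ?thesis
    using l assms by (simp add: alpha_sq beta_sq qint_rec field_simps)
qed

text \<open>
  The type I equation on an edge between equal levels. After clearing denominators, the identity
  labelled \<open>*\<close> remains; \<open>[p-1]\<close> and \<open>[p+2]\<close> enter it only through the squares of \<open>[p-1][p+1]\<close> and
  \<open>[p][p+2]\<close>, which \<open>qint_det\<close> evaluates.
\<close>

lemma alpha_gam_beta_sum: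
  assumes "1 \<le> p" "p < n"
  shows "(alpha p)\<^sup>2 + (gam (Suc p))\<^sup>2 + (beta (Suc p))\<^sup>2 = N 2 * (weight (Suc p))\<^sup>2"
proof -
  obtain r where r: "p = Suc r" using assms by (cases p) auto
  have pos: "N p > 0" "N (Suc p) > 0" using qint_pos assms by auto
  have *: "N (Suc p) * weight p * N (Suc p) + weight (Suc p) + N p * weight (Suc (Suc p)) * N p
      = N 2 * weight (Suc p) * N p * N (Suc p)"
  proof -
    have d: "(N p * N (Suc (Suc p)))\<^sup>2 = ((N (Suc p))\<^sup>2 - 1)\<^sup>2" "(N r * N (Suc p))\<^sup>2 = ((N p)\<^sup>2 - 1)\<^sup>2"
      using qint_det[of p] qint_det[of r] by (simp_all add: r)
    have e: "N 2 * N p * N (Suc p) = (N (Suc p))\<^sup>2 - 1 + (N p)\<^sup>2"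
      using qint_det[of p] qint_rec[of p] by (simp add: algebra_simps power2_eq_square)
    have "N (Suc p) * weight p * N (Suc p) + weight (Suc p) + N p * weight (Suc (Suc p)) * N p
        = (N (Suc p))\<^sup>2 - (N p)\<^sup>2 + (N p * N (Suc (Suc p)))\<^sup>2 - (N r * N (Suc p))\<^sup>2"
      by (simp add: r weight_Suc algebra_simps power2_eq_square)
    also have "\<dots> = weight (Suc p) * (N 2 * N p * N (Suc p))"
      unfolding d e weight_Suc by (simp add: algebra_simps power2_eq_square)
    finally show ?thesis by (simp add: algebra_simps)
  qed
  have "(alpha p)\<^sup>2 + (gam (Suc p))\<^sup>2 + (beta (Suc p))\<^sup>2
      = weight (Suc p) * (N (Suc p) * weight p * N (Suc p) + weight (Suc p) + N p * weight (Suc (Suc p)) * N p)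
         / (N p * N (Suc p))"
    using assms pos by (simp add: alpha_sq beta_sq gam_sq) (simp add: field_simps power2_eq_square)
  also have "\<dots> = N 2 * (weight (Suc p))\<^sup>2"
    unfolding * using pos by (simp add: field_simps power2_eq_square)
  finally show ?thesis .
qed

text \<open>
  The type II equations come in six shapes, according to the levels of the four corners. The six
  identities below are these equations; where a proof contains an identity labelled \<open>*\<close>, it is what
  remains after the common factors are removed. In the first one, the corners alternate between \<open>l\<close> and \<open>l+1\<close>.
\<close>

lemma II_edge_identity:
  assumes "1 \<le> l" "l < n"
  shows "(beta l)^4 / weight l + (alpha l)^4 / weight (Suc l) = weight l * weight (Suc l) * (weight l + weight (Suc l))"
proof -
  obtain p where l: "l = Suc p" using assms by (cases l) auto
  have pos: "N l > 0" "weight l > 0" "weight (Suc l) > 0" using qint_pos weight_pos assms by auto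
  have b: "(beta l)\<^sup>2 = N p * weight l * weight (Suc l) / N l"
    using beta_sq[of p] assms l by (cases "p = 0") (auto simp: beta_1 qint_0)
  have *: "(N p)\<^sup>2 * weight (Suc l) + (N (Suc l))\<^sup>2 * weight l = (N l)\<^sup>2 * (weight l + weight (Suc l))"
    unfolding l weight_Suc by (simp add: algebra_simps)
  have "(beta l)^4 / weight l + (alpha l)^4 / weight (Suc l)
      = ((beta l)\<^sup>2)\<^sup>2 / weight l + ((alpha l)\<^sup>2)\<^sup>2 / weight (Suc l)" by simp
  also have "\<dots> = weight l * weight (Suc l) * ((N p)\<^sup>2 * weight (Suc l) + (N (Suc l))\<^sup>2 * weight l) / (N l)\<^sup>2"
    using pos assms by (simp add: alpha_sq b) (simp add: field_simps power2_eq_square)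
  also have "\<dots> = weight l * weight (Suc l) * (weight l + weight (Suc l))"
    unfolding * using pos by simp
  finally show ?thesis .
qed

text \<open>
  Three corners at level \<open>l\<close> and one at level \<open>l+1\<close>.
\<close>

lemma II_path_low_identity:
  assumes "1 \<le> p" "Suc p < n" and l: "l = Suc p"
  shows "(gam l)\<^sup>2 * (beta l)\<^sup>2 / weight l + (beta l)\<^sup>2 * (alpha l)\<^sup>2 / weight (Suc l) = (weight l)\<^sup>2 * weight (Suc l)"
proof -
  have pos: "N p > 0" "N l > 0" "weight l > 0" "weight (Suc l) > 0" using qint_pos weight_pos assms by auto
  have *: "1 + N p * N (Suc l) = (N l)\<^sup>2"
    using qint_det[of p] unfolding l by algebra
  have "(gam l)\<^sup>2 * (beta l)\<^sup>2 / weight l + (beta l)\<^sup>2 * (alpha l)\<^sup>2 / weight (Suc l)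
      = (weight l)\<^sup>2 * weight (Suc l) * (1 + N p * N (Suc l)) / (N l)\<^sup>2"
    using pos assms by (simp add: alpha_sq beta_sq gam_sq) (simp add: field_simps power2_eq_square)
  also have "\<dots> = (weight l)\<^sup>2 * weight (Suc l)"
    unfolding * using pos by simp
  finally show ?thesis .
qed

text \<open>
  One corner at level \<open>l\<close> and three at level \<open>l+1\<close>.
\<close>

lemma II_path_high_identity:
  assumes "1 \<le> l" "l < n"
  shows "(beta l)\<^sup>2 * (alpha l)\<^sup>2 / weight l + (alpha l)\<^sup>2 * (gam (Suc l))\<^sup>2 / weight (Suc l) = weight l * (weight (Suc l))\<^sup>2"
proof -
  obtain p where l: "l = Suc p" using assms by (cases l) auto
  have pos: "N l > 0" "N (Suc l) > 0" "weight l > 0" "weight (Suc l) > 0" using qint_pos weight_pos assms by auto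
  have b: "(beta l)\<^sup>2 = N p * weight l * weight (Suc l) / N l"
    using beta_sq[of p] assms l by (cases "p = 0") (auto simp: beta_1 qint_0)
  have *: "N p * N (Suc l) + 1 = (N l)\<^sup>2"
    using qint_det[of p] unfolding l by algebra
  have "(beta l)\<^sup>2 * (alpha l)\<^sup>2 / weight l + (alpha l)\<^sup>2 * (gam (Suc l))\<^sup>2 / weight (Suc l)
      = weight l * (weight (Suc l))\<^sup>2 * (N p * N (Suc l) + 1) / (N l)\<^sup>2"
    using pos assms by (simp add: alpha_sq b gam_sq) (simp add: field_simps power2_eq_square)
  also have "\<dots> = weight l * (weight (Suc l))\<^sup>2"
    unfolding * using pos by simp
  finally show ?thesis .
qed

text \<open>
  Two neighbouring corners at level \<open>l\<close> and the other two at level \<open>l+1\<close>. The right-hand side of the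
  equation is zero, and the two terms cancel because \<open>gam\<close> alternates in sign; this is the reason for
  the sign in the solution.
\<close>

lemma II_square_identity:
  assumes "1 \<le> l" "l < n"
  shows "gam l * (beta l)\<^sup>2 * alpha l / weight l + beta l * (alpha l)\<^sup>2 * gam (Suc l) / weight (Suc l) = 0"
proof (cases "l = 1")
  case True
  then show ?thesis by (simp add: beta_1)
next
  case False
  then obtain p where l: "l = Suc p" "1 \<le> p" using assms by (cases l) auto
  have pos: "N p > 0" "N l > 0" "N (Suc l) > 0" "weight l > 0" "weight (Suc l) > 0"
    using qint_pos weight_pos assms l by auto
  have "gam l * beta l * weight (Suc l) = (-1) ^ (l + 1) * weight l * weight (Suc l) * sqrt (weight l * weight (Suc l)) / N l"
    using pos by (simp add: gam_def beta_def l real_sqrt_mult field_simps)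
  moreover have "alpha l * gam (Suc l) * weight l = - ((-1) ^ (l + 1) * weight l * weight (Suc l) * sqrt (weight l * weight (Suc l)) / N l)"
    using pos by (simp add: gam_def alpha_def real_sqrt_mult field_simps)
  ultimately have *: "gam l * beta l * weight (Suc l) + alpha l * gam (Suc l) * weight l = 0" by simp
  have "gam l * (beta l)\<^sup>2 * alpha l / weight l + beta l * (alpha l)\<^sup>2 * gam (Suc l) / weight (Suc l)
      = alpha l * beta l * (gam l * beta l * weight (Suc l) + alpha l * gam (Suc l) * weight l) / (weight l * weight (Suc l))"
    using pos by (simp add: field_simps power2_eq_square)
  then show ?thesis unfolding * by simp
qed

text \<open>
  All four corners at level \<open>l\<close>. The lowest weight \<open>weight p\<close> involves \<open>[p-1]\<close>, which enters
  only through \<open>([p-1][p+1])\<^sup>2\<close>.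
\<close>

lemma II_vertex_identity:
  assumes "1 \<le> p" "p < n" and l: "l = Suc p"
  shows "(alpha p)^4 / weight p + (gam l)^4 / weight l + (beta l)^4 / weight (Suc l) = 2 * (weight l)^3"
proof -
  obtain r where r: "p = Suc r" using assms by (cases p) auto
  have pos: "N p > 0" "N l > 0" "weight p > 0" "weight l > 0" using qint_pos weight_pos assms by auto
  have *: "weight p * (N l)^4 + weight l + weight (Suc l) * (N p)^4 = 2 * weight l * (N p)\<^sup>2 * (N l)\<^sup>2"
  proof -
    have d: "(N p * N (Suc (Suc p)))\<^sup>2 = ((N (Suc p))\<^sup>2 - 1)\<^sup>2" "(N r * N (Suc p))\<^sup>2 = ((N p)\<^sup>2 - 1)\<^sup>2"
      using qint_det[of p] qint_det[of r] by (simp_all add: r)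
    have "weight p * (N l)^4 + weight l + weight (Suc l) * (N p)^4
        = (N p)\<^sup>2 * (N l)^4 - (N r * N (Suc p))\<^sup>2 * (N l)\<^sup>2 + (N l)\<^sup>2 - (N p)\<^sup>2
          + (N p * N (Suc (Suc p)))\<^sup>2 * (N p)\<^sup>2 - (N l)\<^sup>2 * (N p)^4"
      unfolding l weight_Suc by (simp add: r weight_Suc algebra_simps power_mult_distrib power2_eq_square power4_eq_xxxx)
    also have "\<dots> = 2 * weight l * (N p)\<^sup>2 * (N l)\<^sup>2"
      unfolding d unfolding l weight_Suc by (simp add: algebra_simps power2_eq_square power4_eq_xxxx)
    finally show ?thesis .
  qed
  have b: "((beta l)\<^sup>2)\<^sup>2 / weight (Suc l) = (N p)\<^sup>2 * (weight l)\<^sup>2 * weight (Suc l) / (N l)\<^sup>2"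
    using assms pos by (cases "weight (Suc l) = 0") (simp_all add: beta_sq power_divide power_mult_distrib, simp add: power2_eq_square)
  have a: "((alpha p)\<^sup>2)\<^sup>2 / weight p = (N l)\<^sup>2 * (weight l)\<^sup>2 * weight p / (N p)\<^sup>2"
    using assms pos by (simp add: alpha_sq power_divide power_mult_distrib) (simp add: power2_eq_square)
  have g: "((gam l)\<^sup>2)\<^sup>2 / weight l = (weight l)^3 / ((N p)\<^sup>2 * (N l)\<^sup>2)"
    using assms pos by (simp add: gam_sq power_divide power_mult_distrib) (simp add: power2_eq_square power3_eq_cube power4_eq_xxxx)
  have "(alpha p)^4 / weight p + (gam l)^4 / weight l + (beta l)^4 / weight (Suc l)
      = ((alpha p)\<^sup>2)\<^sup>2 / weight p + ((gam l)\<^sup>2)\<^sup>2 / weight l + ((beta l)\<^sup>2)\<^sup>2 / weight (Suc l)" by simp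
  also have "\<dots> = (weight l)\<^sup>2 * (weight p * (N l)^4 + weight l + weight (Suc l) * (N p)^4) / ((N p)\<^sup>2 * (N l)\<^sup>2)"
    unfolding a b g using pos by (simp add: field_simps power2_eq_square power3_eq_cube power4_eq_xxxx)
  also have "\<dots> = 2 * (weight l)^3"
    unfolding * using pos by (simp add: field_simps power2_eq_square power3_eq_cube)
  finally show ?thesis .
qed

text \<open>
  Opposite corners at levels \<open>p\<close> and \<open>p+2\<close>, the other two in between; only one level is adjacent to all
  corners.
\<close>

lemma II_skip_identity:
  assumes "1 \<le> p" "Suc p < n" and l: "l = Suc p"
  shows "(alpha p)\<^sup>2 * (beta l)\<^sup>2 / weight l = weight p * weight l * weight (Suc l)"
proof -
  have pos: "N p > 0" "N l > 0" "weight p > 0" "weight l > 0" using qint_pos weight_pos assms by auto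
  then show ?thesis using assms by (simp add: alpha_sq beta_sq)
qed

section \<open>Common neighbours of levels\<close>

definition common :: "nat set \<Rightarrow> nat set" where
  "common S = {c. \<forall>x\<in>S. adj x c}"

lemma common_neighbours_eq:
  "{c. adj b c \<and> adj c a} = common {a, b}"
  "{c. adj b c \<and> adj c a \<and> adj c a' \<and> adj b' c} = common {a, b, a', b'}"
  by (auto simp: common_def adj_sym)

text \<open>
  The hypothesis at the top level makes it possible to treat \<open>p + 1 = n\<close>, where \<open>p + 2\<close> is not a
  level, like the interior case: the summands of interest vanish beyond the end of the graph.
\<close>

lemma sum_common_vertex:
  fixes F :: "nat \<Rightarrow> 'a::comm_monoid_add"
  assumes "1 \<le> p" "p < n" "Suc p = n \<Longrightarrow> F (Suc n) = 0"
  shows "sum F (common {Suc p}) = F p + F (Suc p) + F (Suc (Suc p))"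
proof (cases "Suc p = n")
  case True
  then have "common {Suc p} = {p, Suc p}" using assms by (auto simp: common_def adj_def)
  then show ?thesis using True assms(3) by simp
next
  case False
  then have "common {Suc p} = {p, Suc p, Suc (Suc p)}" using assms by (auto simp: common_def adj_def)
  then show ?thesis by (simp add: add.assoc)
qed

text \<open>
  The levels \<open>1, 2, 1\<close> do not form a triangle; by the hypothesis at \<open>l = 1\<close> the
  summand at this missing level may be counted, as it vanishes.
\<close>

lemma sum_common_edge:
  fixes F :: "nat \<Rightarrow> 'a::comm_monoid_add"
  assumes "1 \<le> l" "l < n" "l = 1 \<Longrightarrow> F 1 = 0"
  shows "sum F (common {l, Suc l}) = F l + F (Suc l)"
proof (cases "l = 1")
  case True
  then have "common {l, Suc l} = {Suc l}" using n2 by (auto simp: common_def adj_def)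
  then show ?thesis using True assms(3) by simp
next
  case False
  then have "common {l, Suc l} = {l, Suc l}" using assms by (auto simp: common_def adj_def)
  then show ?thesis by simp
qed

lemma common_skip:
  assumes "1 \<le> p" "Suc p < n"
  shows "common {p, Suc p, Suc (Suc p)} = {Suc p}"
  using assms by (auto simp: common_def adj_def)

lemma adj_cases:
  assumes "adj a b"
  obtains p where "1 \<le> p" "p < n" "a = Suc p" "b = Suc p"
    | l where "1 \<le> l" "l < n" "a = l" "b = Suc l"
    | l where "1 \<le> l" "l < n" "a = Suc l" "b = l"
proof -
  have "a \<le> Suc b" "b \<le> Suc a" using assms by (simp_all add: adj_def)
  then consider (1) "a = b" | (2) "b = Suc a" | (3) "a = Suc b" by linarith
  then show thesis
  proof cases
    case 1
    obtain p where p: "a = Suc p" using assms by (cases a) (auto simp: adj_def)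
    have "1 \<le> p" "p < n" using assms p 1 by (auto simp: adj_def)
    then show ?thesis using p 1 by (intro that(1)[of p]) simp_all
  next
    case 2
    have "1 \<le> a" "a < n" using assms 2 by (auto simp: adj_def)
    then show ?thesis using 2 by (intro that(2)[of a]) simp_all
  next
    case 3
    have "1 \<le> b" "b < n" using assms 3 by (auto simp: adj_def)
    then show ?thesis using 3 by (intro that(3)[of b]) simp_all
  qed
qed

text \<open>
  Let \<open>l\<close> be the lowest corner. If no corner exceeds \<open>l + 1\<close>, the square is constant or lies on
  \<open>{l, l + 1}\<close>. Otherwise the corner opposite to \<open>l\<close> is at \<open>l + 2\<close>, since
  neighbouring corners differ by at most one, and the other two are at \<open>l + 1\<close>.
\<close>

lemma adj_square_cases:
  assumes "adj a b" "adj a' b" "adj a' b'" "adj a b'"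
  obtains (vertex) p where "1 \<le> p" "p < n" "a = Suc p" "b = Suc p" "a' = Suc p" "b' = Suc p"
    | (edge) l where "1 \<le> l" "l < n" "a \<in> {l, Suc l}" "b \<in> {l, Suc l}" "a' \<in> {l, Suc l}" "b' \<in> {l, Suc l}"
        "{a, b, a', b'} = {l, Suc l}"
    | (skip) p where "1 \<le> p" "Suc p < n"
        "(a = Suc p \<and> a' = Suc p \<and> {b, b'} = {p, Suc (Suc p)}) \<or>
         (b = Suc p \<and> b' = Suc p \<and> {a, a'} = {p, Suc (Suc p)})"
proof -
  define l where "l = min (min a b) (min a' b')"
  have le: "l \<le> a" "l \<le> b" "l \<le> a'" "l \<le> b'" and mem: "l \<in> {a, b, a', b'}"
    by (auto simp: l_def min_def)
  have l1: "1 \<le> l" and ln: "l \<le> n" using assms mem by (auto simp: adj_def)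
  consider "a \<le> Suc l \<and> b \<le> Suc l \<and> a' \<le> Suc l \<and> b' \<le> Suc l"
    | "\<not> (a \<le> Suc l \<and> b \<le> Suc l \<and> a' \<le> Suc l \<and> b' \<le> Suc l)" by blast
  then show thesis
  proof cases
    case 1
    then have m: "a \<in> {l, Suc l}" "b \<in> {l, Suc l}" "a' \<in> {l, Suc l}" "b' \<in> {l, Suc l}"
      using le by auto
    show ?thesis
    proof (cases "a = l \<and> b = l \<and> a' = l \<and> b' = l")
      case True
      moreover obtain p where "l = Suc p" using l1 by (cases l) auto
      ultimately show ?thesis using vertex[of p] assms(1) by (simp add: adj_def)
    next
      case False
      then have top: "Suc l \<in> {a, b, a', b'}" using m by auto
      then have "Suc l \<le> n" using assms by (auto simp: adj_def)
      moreover have "{a, b, a', b'} = {l, Suc l}"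
        using m top mem by (intro equalityI subsetI) auto
      ultimately show ?thesis using edge[of l] m l1 by simp
    qed
  next
    case 2
    from assms have near: "a \<le> Suc b" "b \<le> Suc a" "a' \<le> Suc b" "b \<le> Suc a'"
        "a' \<le> Suc b'" "b' \<le> Suc a'" "a \<le> Suc b'" "b' \<le> Suc a"
      by (auto simp: adj_def)
    from mem consider "a = l" | "b = l" | "a' = l" | "b' = l" by blast
    then show ?thesis
    proof cases
      case 1
      then have "b = Suc l" "b' = Suc l" "a' = Suc (Suc l)" using near le 2 by linarith+
      then show ?thesis using skip[of l] l1 1 assms by (simp add: adj_def)
    next
      case b: 2
      then have "a = Suc l" "a' = Suc l" "b' = Suc (Suc l)" using near le 2 by linarith+
      then show ?thesis using skip[of l] l1 b assms by (simp add: adj_def)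
    next
      case 3
      then have "b = Suc l" "b' = Suc l" "a = Suc (Suc l)" using near le 2 by linarith+
      then show ?thesis using skip[of l] l1 3 assms by (simp add: adj_def insert_commute)
    next
      case 4
      then have "a = Suc l" "a' = Suc l" "b = Suc (Suc l)" using near le 2 by linarith+
      then show ?thesis using skip[of l] l1 4 assms by (simp add: adj_def insert_commute)
    qed
  qed
qed

section \<open>The explicit solution is a cell system\<close>

lemma V_level_I:
  assumes "adj a b"
  shows "(\<Sum>c\<in>common {a, b}. (V a b c)\<^sup>2) = N 2 * weight a * weight b"
  using assms
proof (cases rule: adj_cases)
  case (1 p)
  have "Suc p = n \<Longrightarrow> (V (Suc p) (Suc p) (Suc n))\<^sup>2 = 0"
    using n2 by (simp add: V_level beta_top)
  then show ?thesis
    using 1 alpha_gam_beta_sum[of p]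
    by (simp add: sum_common_vertex V_level power2_eq_square)
next
  case (2 l)
  have "l = 1 \<Longrightarrow> (V l (Suc l) 1)\<^sup>2 = 0" by (simp add: V_level beta_1)
  then show ?thesis
    unfolding 2(3,4) using alpha_beta_sum[of l] 2(1,2)
    by (simp add: sum_common_edge V_level)
next
  case (3 l)
  have "l = 1 \<Longrightarrow> (V (Suc l) l 1)\<^sup>2 = 0" by (simp add: V_level beta_1)
  then show ?thesis
    unfolding 3(3,4) insert_commute[of "Suc l" l] using alpha_beta_sum[of l] 3(1,2)
    by (simp add: sum_common_edge V_level)
qed

lemma V_level_II:
  assumes adj: "adj a b" "adj a' b" "adj a' b'" "adj a b'"
  shows "(\<Sum>c\<in>common {a, b, a', b'}. V a b c * V a' b c * V a' b' c * V a b' c / weight c)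
     = of_bool (b = b') * (weight a * weight b * weight a') + of_bool (a = a') * (weight a * weight b * weight b')"
  using adj
proof (cases rule: adj_square_cases)
  case (vertex p)
  have "Suc p = n \<Longrightarrow> V (Suc p) (Suc p) (Suc n) = 0"
    using n2 by (simp add: V_level beta_top)
  then show ?thesis
    using vertex II_vertex_identity[of p "Suc p"]
    by (simp add: sum_common_vertex V_level power4_eq_xxxx power3_eq_cube)
next
  case (skip p)
  from skip(3) have "{a, b, a', b'} = {p, Suc p, Suc (Suc p)}"
    by (elim disjE conjE) (hypsubst, blast)+
  then have c: "common {a, b, a', b'} = {Suc p}"
    using common_skip[OF skip(1,2)] by simp
  show ?thesis
    unfolding c using skip II_skip_identity[of p "Suc p"]
    by (auto simp: doubleton_eq_iff V_level power2_eq_square mult_ac)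
next
  case (edge l)
  have c: "(\<Sum>c\<in>common {a, b, a', b'}. V a b c * V a' b c * V a' b' c * V a b' c / weight c)
    = V a b l * V a' b l * V a' b' l * V a b' l / weight l
      + V a b (Suc l) * V a' b (Suc l) * V a' b' (Suc l) * V a b' (Suc l) / weight (Suc l)"
    unfolding edge(7)
  proof (rule sum_common_edge[OF edge(1,2)])
    assume l: "l = 1"
    have "1 \<in> {a, b, a', b'}" using edge(7) l by blast
    moreover have "adj 1 x \<Longrightarrow> x = Suc 1" "adj x 1 \<Longrightarrow> x = Suc 1" for x by (auto simp: adj_def)
    ultimately consider "a = 1 \<and> b = Suc 1" | "a = Suc 1 \<and> b = 1" | "a' = 1 \<and> b' = Suc 1" | "a' = Suc 1 \<and> b' = 1"
      using adj by blast
    then show "V a b 1 * V a' b 1 * V a' b' 1 * V a b' 1 / weight 1 = 0"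
      using V_level(3)[of 1] V_level(4)[of 1] beta_1 by cases auto
  qed
  have low: "(gam l)\<^sup>2 * (beta l)\<^sup>2 / weight l + (beta l)\<^sup>2 * (alpha l)\<^sup>2 / weight (Suc l) = (weight l)\<^sup>2 * weight (Suc l)"
    if "adj l l" 
    using II_path_low_identity[of "l - 1" l] that edge(2) by (auto simp: adj_def)
  note ids = II_edge_identity[OF edge(1,2)] II_path_high_identity[OF edge(1,2)]
    II_square_identity[OF edge(1,2)]
  have V: "V l l l = gam l" "V (Suc l) (Suc l) (Suc l) = gam (Suc l)"
    "V l l (Suc l) = beta l" "V l (Suc l) l = beta l" "V (Suc l) l l = beta l"
    "V l (Suc l) (Suc l) = alpha l" "V (Suc l) l (Suc l) = alpha l" "V (Suc l) (Suc l) l = alpha l"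
    using edge(1) by (auto simp: V_level)
  \<comment> \<open>On an edge pattern each corner is one of two levels; the two constant patterns are impossible.\<close>
  have neq: "{l} \<noteq> {l, Suc l}" "{Suc l} \<noteq> {l, Suc l}" by auto
  from edge(3-7) adj show ?thesis
    unfolding c
    by (elim insertE emptyE; hypsubst_thin?)
      (use low ids neq in \<open>simp_all add: V power2_eq_square power4_eq_xxxx algebra_simps\<close>)
qed

text \<open>
  The levels of a triangle are pairwise adjacent, hence take at most two values. The pattern with two
  equal low levels needs an edge between vertices of that level, which excludes level 1.
\<close>

lemma level_triangle_cases:
  assumes "adj a b" "adj b c" "adj c a"
  obtains (vertex) p where "1 \<le> p" "p < n" "a = Suc p" "b = Suc p" "c = Suc p"
    | (low) l where "2 \<le> l" "l < n"
       "(a, b, c) \<in> {(l, l, Suc l), (l, Suc l, l), (Suc l, l, l)}"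
    | (high) l where "1 \<le> l" "l < n"
       "(a, b, c) \<in> {(l, Suc l, Suc l), (Suc l, l, Suc l), (Suc l, Suc l, l)}"
  using assms(1)
proof (cases rule: adj_cases)
  case (1 p)
  then consider "c = p" | "c = Suc p" | "c = Suc (Suc p)" using assms unfolding adj_def by linarith
  then show thesis
  proof cases
    case 1
    then show ?thesis using high[of p] \<open>a = Suc p\<close> \<open>b = Suc p\<close> \<open>1 \<le> p\<close> \<open>p < n\<close> by simp
  next
    case 2
    then show ?thesis using vertex[of p] \<open>a = Suc p\<close> \<open>b = Suc p\<close> \<open>1 \<le> p\<close> \<open>p < n\<close> by simp
  next
    case 3
    then show ?thesis using low[of "Suc p"] \<open>a = Suc p\<close> \<open>b = Suc p\<close> \<open>1 \<le> p\<close> assms by (simp add: adj_def)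
  qed
next
  case (2 l)
  then consider "c = l" "2 \<le> l" | "c = Suc l" using assms unfolding adj_def by linarith
  then show thesis using 2 low[of l] high[of l] by cases simp_all
next
  case (3 l)
  then consider "c = l" "2 \<le> l" | "c = Suc l" using assms unfolding adj_def by linarith
  then show thesis using 3 low[of l] high[of l] by cases simp_all
qed

lemma alpha_nonzero: "1 \<le> l \<Longrightarrow> l < n \<Longrightarrow> alpha l \<noteq> 0"
  using qint_pos[of l] qint_pos[of "Suc l"] weight_pos[of l] weight_pos[of "Suc l"] by (simp add: alpha_def)

lemma beta_nonzero: "2 \<le> l \<Longrightarrow> l < n \<Longrightarrow> beta l \<noteq> 0"
  using qint_pos[of l] qint_pos[of "l - 1"] weight_pos[of l] weight_pos[of "Suc l"] by (force simp: beta_def)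

lemma gam_nonzero: "2 \<le> l \<Longrightarrow> l \<le> n \<Longrightarrow> gam l \<noteq> 0"
  using qint_pos[of l] qint_pos[of "l - 1"] weight_pos[of l] by (force simp: gam_def)

text \<open>
  Since no value vanishes, the quotient of a cell system by the explicit solution is defined on every
  triangle.
\<close>

lemma V_nonzero:
  assumes "adj a b" "adj b c" "adj c a"
  shows "V a b c \<noteq> 0"
  using assms
proof (cases rule: level_triangle_cases)
  case (vertex p)
  then show ?thesis using gam_nonzero[of "Suc p"] by (simp add: V_level)
next
  case (low l)
  then show ?thesis using beta_nonzero[of l] by (auto simp: V_level)
next
  case (high l)
  then show ?thesis using alpha_nonzero[of l] by (auto simp: V_level)
qed

lemma cell_at_solution:
  assumes "colouring X Y Z"
  shows "cell_at (Dstar_solution n) (X a) (Y b) (Z c) = complex_of_real (V a b c)"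
  using assms V_rotate[of a b c] V_rotate[of b c a]
  by (auto simp: colouring_def cell_at_def)

lemma fin_digraph_Dstar: "fin_digraph (Dstar n)"
proof
  fix e assume e: "e \<in> arcs (Dstar n)"
  then obtain X Y Z a b where c: "colouring X Y Z" and ab: "adj a b" and eq: "e = (X a, Y b)"
    by (rule Dstar_arcE)
  have "tail (Dstar n) e = fst e" "head (Dstar n) e = snd e" by (simp_all add: Dstar_def Let_def)
  then show "tail (Dstar n) e \<in> verts (Dstar n)" "head (Dstar n) e \<in> verts (Dstar n)"
    using colouring_in_verts[OF c] adj_range[OF ab] eq by auto
next
  show "finite (verts (Dstar n))" by (simp add: Dstar_def Let_def)
  have "finite {(l, m). l \<in> {1..n} \<and> m \<in> {1..n} \<and> \<bar>int l - int m\<bar> \<le> 1 \<and> (l, m) \<noteq> (1, 1)}"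
    by (rule finite_subset[of _ "{1..n} \<times> {1..n}"]) auto
  then show "finite (arcs (Dstar n))" by (simp add: Dstar_def Let_def)
qed

lemma out_arcs_Dstar:
  assumes c: "colouring X Y Z"
  shows "out_arcs (Dstar n) (X a) = (\<lambda>b. (X a, Y b)) ` {b. adj a b}"
proof -
  have "e \<in> out_arcs (Dstar n) (X a) \<longleftrightarrow> e \<in> edges (Dstar n) (X a) (snd e)" for e
    by (auto simp: out_arcs_def edges_def Dstar_def Let_def)
  moreover have "e \<in> edges (Dstar n) (X a) v \<longleftrightarrow> (\<exists>b. v = Y b \<and> adj a b \<and> e = (X a, v))" for e v
  proof
    assume e: "e \<in> edges (Dstar n) (X a) v"
    then have "v \<in> verts (Dstar n)"
      using wf_digraph.head_in_verts[OF fin_digraph.axioms(1)[OF fin_digraph_Dstar], of e]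
      by (simp add: edges_def)
    then show "\<exists>b. v = Y b \<and> adj a b \<and> e = (X a, v)"
      using e by (cases rule: Dstar_vertE[OF _ c]) (auto simp: edges_Dstar[OF c] split: if_splits)
  next
    assume "\<exists>b. v = Y b \<and> adj a b \<and> e = (X a, v)"
    then show "e \<in> edges (Dstar n) (X a) v" by (auto simp: edges_Dstar[OF c])
  qed
  ultimately show ?thesis by force
qed

text \<open>
  The eigenvector equation at an interior level is the fusion rule \<open>[3][m] = [m-2] + [m] + [m+2]\<close>
  for \<open>m = 2a-1\<close>; at the top one term is \<open>[2n+1] = 0\<close>, and at level 1 it is \<open>[3][1] = [3]\<close>.
\<close>

lemma weight_eigenvector:
  assumes "a \<in> {1..n}"
  shows "(\<Sum>b | adj a b. weight b) = N 3 * weight a"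
proof (cases "a = 1")
  case True
  have "{b. adj a b} = {2}" using n2 True by (auto simp: adj_def)
  then show ?thesis using True by (simp add: weight_def qint_1 numeral_3_eq_3)
next
  case False
  then obtain r where a: "a = Suc (Suc r)" using assms by (metis One_nat_def atLeastAtMost_iff not0_implies_Suc not_one_le_zero)
  have "{b. adj a b} = common {Suc (Suc r)}" by (simp add: common_def a)
  then have "(\<Sum>b | adj a b. weight b) = weight (Suc r) + weight (Suc (Suc r)) + weight (Suc (Suc (Suc r)))"
    using sum_common_vertex[of "Suc r" weight] assms a weight_top by simp
  also have "\<dots> = N 3 * weight (Suc (Suc r))"
    using qint_det[of r] qint_det[of "Suc r"] qint_rec[of r] qint_rec[of "Suc r"]
    unfolding weight_Suc qint_3 by algebra
  finally show ?thesis by (simp add: a)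
qed

lemma PF_eigenvector_Dstar: "PF_eigenvector (Dstar n) (N 3) (Dstar_phi n)"
proof -
  have "0 < Dstar_phi n v \<and> (\<Sum>e\<in>out_arcs (Dstar n) v. Dstar_phi n (head (Dstar n) e)) = N 3 * Dstar_phi n v"
    if "v \<in> verts (Dstar n)" for v
  proof -
    have "colouring vi vj vk" by (simp add: colouring_def)
    from that verts_Dstar[OF this] consider a where "v = vi a" "a \<in> {1..n}"
      | a where "v = vj a" "a \<in> {1..n}" | a where "v = vk a" "a \<in> {1..n}" by blast
    then obtain X Y Z a where c: "colouring X Y Z" and v: "v = X a" and a: "a \<in> {1..n}"
      unfolding colouring_def by cases blast+
    have "inj_on (\<lambda>b. (X a, Y b)) A" for A
      using colouring_inj[OF colouring_rotate[OF c]] by (auto simp: inj_on_def)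
    moreover have "head (Dstar n) = snd" by (simp add: Dstar_def Let_def)
    ultimately have "(\<Sum>e\<in>out_arcs (Dstar n) v. Dstar_phi n (head (Dstar n) e)) = (\<Sum>b | adj a b. weight b)"
      by (simp add: v out_arcs_Dstar[OF c] sum.reindex Dstar_phi_colouring[OF colouring_rotate[OF c]])
    then show ?thesis
      using weight_eigenvector[OF a] weight_pos[of a] a by (simp add: v Dstar_phi_colouring[OF c])
  qed
  then show ?thesis by (simp add: PF_eigenvector_def)
qed

lemma Dstar_triangleE:
  assumes "triangle (Dstar n) e1 e2 e3"
  obtains X Y Z a b c where "colouring X Y Z" "adj a b" "adj b c" "adj c a"
    "e1 = (X a, Y b)" "e2 = (Y b, Z c)" "e3 = (Z c, X a)"
proof -
  have ht: "tail (Dstar n) = fst" "head (Dstar n) = snd" by (simp_all add: Dstar_def Let_def)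
  from assms have "e1 \<in> arcs (Dstar n)" by (simp add: triangle_def)
  then obtain X Y Z a b where c: "colouring X Y Z" and ab: "adj a b" "e1 = (X a, Y b)"
    by (rule Dstar_arcE)
  note c2 = colouring_rotate[OF c] note c3 = colouring_rotate[OF c2]
  have "e2 \<in> out_arcs (Dstar n) (Y b)" using assms ab by (auto simp: triangle_def ht)
  then obtain d where d: "adj b d" "e2 = (Y b, Z d)" unfolding out_arcs_Dstar[OF c2] by blast
  have "e3 \<in> out_arcs (Dstar n) (Z d)" using assms d by (auto simp: triangle_def ht)
  then obtain a' where a': "adj d a'" "e3 = (Z d, X a')" unfolding out_arcs_Dstar[OF c3] by blast
  have "a' = a" using assms ab a' colouring_inj[OF c] by (auto simp: triangle_def ht)
  then show ?thesis using that c ab d a' by blast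
qed

lemma triangle_Dstar:
  assumes c: "colouring X Y Z" and adj: "adj a b" "adj b d" "adj d a"
  shows "triangle (Dstar n) (X a, Y b) (Y b, Z d) (Z d, X a)"
proof -
  note c2 = colouring_rotate[OF c] note c3 = colouring_rotate[OF c2]
  have "(X a, Y b) \<in> edges (Dstar n) (X a) (Y b)" "(Y b, Z d) \<in> edges (Dstar n) (Y b) (Z d)"
    "(Z d, X a) \<in> edges (Dstar n) (Z d) (X a)"
    using adj by (simp_all add: edges_Dstar[OF c] edges_Dstar[OF c2] edges_Dstar[OF c3])
  then show ?thesis by (simp add: edges_def triangle_def)
qed

lemma Dstar_solution_cell_system: "Dstar_cell_system n (Dstar_solution n)"
  unfolding cell_system_def
proof (intro conjI fin_digraph_Dstar PF_eigenvector_Dstar)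
  show "rotation_invariant (Dstar n) (Dstar_solution n)"
    unfolding rotation_invariant_def
  proof (intro allI impI)
    fix e1 e2 e3 assume "triangle (Dstar n) e1 e2 e3"
    then show "Dstar_solution n e1 e2 e3 = Dstar_solution n e2 e3 e1"
      by (rule Dstar_triangleE) (auto simp: colouring_def)
  qed
  show "type_I (Dstar_q n) (Dstar n) (Dstar_phi n) (Dstar_solution n)"
    unfolding type_I_levels level_I_def common_neighbours_eq
  proof (intro allI impI)
    fix X Y Z a b assume c: "colouring X Y Z" and ab: "adj a b"
    show "(\<Sum>d\<in>common {a, b}. cell_at (Dstar_solution n) (X a) (Y b) (Z d)
        * cnj (cell_at (Dstar_solution n) (X a) (Y b) (Z d))) = complex_of_real (N 2 * weight a * weight b)"
      unfolding cell_at_solution[OF c] V_level_I[OF ab, symmetric]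
      by (simp add: power2_eq_square)
  qed
  show "type_II (Dstar n) (Dstar_phi n) (Dstar_solution n)"
    unfolding type_II_levels level_II_def common_neighbours_eq
  proof (intro allI impI)
    fix X Y Z a b a' b'
    assume c: "colouring X Y Z" and adj: "adj a b" "adj a' b" "adj a' b'" "adj a b'"
    show "(\<Sum>d\<in>common {a, b, a', b'}. complex_of_real (inverse (weight d))
        * cell_at (Dstar_solution n) (X a) (Y b) (Z d)
        * cnj (cell_at (Dstar_solution n) (X a') (Y b) (Z d))
        * cell_at (Dstar_solution n) (X a') (Y b') (Z d)
        * cnj (cell_at (Dstar_solution n) (X a) (Y b') (Z d)))
      = of_bool (b = b') * complex_of_real (weight a * weight b * weight a')
        + of_bool (a = a') * complex_of_real (weight a * weight b * weight b')"
      unfolding cell_at_solution[OF c]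
      using arg_cong[OF V_level_II[OF adj], of complex_of_real]
      by (simp add: divide_inverse mult_ac)
  qed
qed

lemma Dstar_solution_symmetric: "Z3_symmetric_solution n (Dstar_solution n)"
proof -
  have "colouring vi vj vk" by (simp add: colouring_def)
  then show ?thesis
    using Dstar_solution_cell_system
    by (auto simp: Z3_symmetric_solution_def cell_at_solution intro: V_rotate[THEN arg_cong])
qed

section \<open>Absolute values of a symmetric solution\<close>

text \<open>
  One symmetric family of squared absolute values \<open>M\<close> is determined level by level. The type II
  equation \<open>skip\<close> has only one summand, a product of the values on two adjacent levels, and this makes
  the recursion linear; the type II equations on a single edge, which are quadratic in the unknown, are
  avoided.
\<close>

lemma cell_moduli:
  assumes I: "level_I w" and II: "level_II w"
    and sym: "\<And>a b c. adj a b \<Longrightarrow> adj b c \<Longrightarrow> adj c a \<Longrightarrow> cmod (w a b c) = cmod (w b c a)"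
    and adj: "adj a b" "adj b c" "adj c a"
  shows "cmod (w a b c) = \<bar>V a b c\<bar>"
proof -
  define M where "M = (\<lambda>a b c. (cmod (w a b c))\<^sup>2)"
  have M: "w a b c * cnj (w a b c) = complex_of_real (M a b c)" for a b c
    unfolding M_def complex_norm_square by simp
  have sumM: "(\<Sum>c\<in>common {a, b}. M a b c) = N 2 * weight a * weight b" if "adj a b" for a b
  proof -
    have "complex_of_real (\<Sum>c\<in>common {a, b}. M a b c) = complex_of_real (N 2 * weight a * weight b)"
      using I that unfolding level_I_def common_neighbours_eq M by simp
    then show ?thesis by (simp only: of_real_eq_iff)
  qed
  have rot: "M a b c = M b c a" if "adj a b" "adj b c" "adj c a" for a b c
    using sym[OF that] by (simp add: M_def)
  have skip: "M (Suc p) p (Suc p) * M (Suc p) (Suc (Suc p)) (Suc p) / weight (Suc p)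
      = weight p * weight (Suc p) * weight (Suc (Suc p))" if p: "1 \<le> p" "Suc p < n" for p
  proof -
    have adj: "adj (Suc p) p" "adj (Suc p) (Suc (Suc p))" using p by (auto simp: adj_def)
    have c: "common {Suc p, p, Suc p, Suc (Suc p)} = {Suc p}"
      using common_skip[OF p] by (simp add: insert_commute)
    have "complex_of_real (inverse (weight (Suc p)))
        * (w (Suc p) p (Suc p) * cnj (w (Suc p) p (Suc p)))
        * (w (Suc p) (Suc (Suc p)) (Suc p) * cnj (w (Suc p) (Suc (Suc p)) (Suc p)))
      = complex_of_real (weight (Suc p) * weight p * weight (Suc (Suc p)))"
      using II[unfolded level_II_def common_neighbours_eq, rule_format, OF adj(1) adj(1) adj(2) adj(2)]
      unfolding c by (simp add: mult_ac)
    then have "inverse (weight (Suc p)) * M (Suc p) p (Suc p) * M (Suc p) (Suc (Suc p)) (Suc p)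
        = weight (Suc p) * weight p * weight (Suc (Suc p))"
      unfolding M by (simp only: of_real_eq_iff flip: of_real_mult)
    then show ?thesis by (simp add: divide_inverse mult_ac)
  qed
  \<comment> \<open>The induction carries both values at level l; those at level 1 start it since (1,1,2) is no triangle.\<close>
  have AB: "M l (Suc l) (Suc l) = (alpha l)\<^sup>2 \<and> (2 \<le> l \<longrightarrow> M l l (Suc l) = (beta l)\<^sup>2)"
    if "1 \<le> l" "l < n" for l
    using that
  proof (induction l rule: nat_induct_at_least)
    case base
    have "adj 1 (Suc 1)" using n2 by (simp add: adj_def)
    moreover have "common {1, Suc 1} = {Suc 1}" using n2 by (auto simp: common_def adj_def)
    ultimately show ?case using sumM[of 1 "Suc 1"] alpha_beta_sum[of 1] n2 by (simp add: beta_1)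
  next
    case (Suc p)
    let ?l = "Suc p"
    have p: "1 \<le> p" "Suc p < n" "p < n" using Suc by auto
    have adj: "adj p ?l" "adj ?l p" "adj ?l ?l" "adj ?l (Suc ?l)" "adj (Suc ?l) ?l"
      using p by (auto simp: adj_def)
    have "M ?l p ?l = (alpha p)\<^sup>2"
      using Suc.IH p rot[of ?l p ?l] adj by simp
    moreover have "M ?l (Suc ?l) ?l = M ?l ?l (Suc ?l)"
      using rot[of ?l ?l "Suc ?l"] adj by simp
    ultimately have "(alpha p)\<^sup>2 * M ?l ?l (Suc ?l) / weight ?l = (alpha p)\<^sup>2 * (beta ?l)\<^sup>2 / weight ?l"
      using skip[OF p(1,2)] II_skip_identity[OF p(1,2) refl] by simp
    then have B: "M ?l ?l (Suc ?l) = (beta ?l)\<^sup>2"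
      using alpha_nonzero[OF p(1,3)] weight_pos[of ?l] p by simp
    have "M ?l (Suc ?l) ?l + M ?l (Suc ?l) (Suc ?l) = N 2 * weight ?l * weight (Suc ?l)"
      using sumM[OF adj(4)] sum_common_edge[of ?l "M ?l (Suc ?l)"] p by simp
    then have "M ?l (Suc ?l) (Suc ?l) = (alpha ?l)\<^sup>2"
      using alpha_beta_sum[of ?l] B \<open>M ?l (Suc ?l) ?l = M ?l ?l (Suc ?l)\<close> p by simp
    with B show ?case by simp
  qed
  from adj have "M a b c = (V a b c)\<^sup>2"
  proof (cases rule: level_triangle_cases)
    case (vertex p)
    let ?l = "Suc p"
    have adj': "adj p ?l" "adj ?l p" "adj ?l ?l" using vertex by (auto simp: adj_def)
    have A: "M ?l ?l p = (alpha p)\<^sup>2" using AB[of p] vertex rot[of p ?l ?l] rot[of ?l ?l p] adj' by simp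
    show ?thesis
    proof (cases "?l = n")
      case True
      have "common {?l} = {p, ?l}" using True vertex(1,2) by (auto simp: common_def adj_def)
      then have "M ?l ?l p + M ?l ?l ?l = N 2 * weight ?l * weight ?l"
        using sumM[OF adj'(3)] by simp
      then show ?thesis
        using A alpha_gam_beta_sum[of p] vertex True beta_top by (simp add: V_level power2_eq_square)
    next
      case False
      then have "M ?l ?l p + M ?l ?l ?l + M ?l ?l (Suc ?l) = N 2 * weight ?l * weight ?l"
        using sumM[OF adj'(3)] sum_common_vertex[of p "M ?l ?l"] vertex by simp
      then show ?thesis
        using A AB[of ?l] alpha_gam_beta_sum[of p] vertex False by (simp add: V_level power2_eq_square)
    qed
  next
    case (low l)
    have adj': "adj l l" "adj l (Suc l)" "adj (Suc l) l" using low by (auto simp: adj_def)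
    have "M l l (Suc l) = M l (Suc l) l" "M l (Suc l) l = M (Suc l) l l"
      using rot[of l l "Suc l"] rot[of l "Suc l" l] adj' by auto
    then show ?thesis using AB[of l] low by (auto simp: V_level)
  next
    case (high l)
    have adj': "adj (Suc l) (Suc l)" "adj l (Suc l)" "adj (Suc l) l" using high by (auto simp: adj_def)
    have "M l (Suc l) (Suc l) = M (Suc l) (Suc l) l" "M (Suc l) (Suc l) l = M (Suc l) l (Suc l)"
      using rot[of l "Suc l" "Suc l"] rot[of "Suc l" "Suc l" l] adj' by auto
    then show ?thesis using AB[of l] high by (auto simp: V_level)
  qed
  then show ?thesis unfolding M_def by (metis abs_norm_cancel power2_eq_iff abs_minus_cancel abs_idempotent)
qed

section \<open>Removing the phases\<close>

text \<open>
  The phases on constant triangles are put into \<open>f a a\<close>, with \<open>g a a = h a a = 1\<close>, so that the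
  cubes \<open>{l, m}\<^sup>3\<close>, \<open>m = l + 1\<close>, which share only constant triangles, can be treated independently. In one
  cube there remain six phases, and each of the six mixed triangles involves two of them, in the cyclic
  order \<open>f l m, g m l, h l m, f m l, g l m, h m l\<close>. Starting from \<open>f l m = 1\<close>, five triangles determine the
  other five phases; the sixth, \<open>(l, l, m)\<close>, closes the cycle, and it does so by the cocycle relation.
  For \<open>l = 1\<close> the triangle \<open>(1, 1, 2)\<close> does not exist and nothing has to close.
\<close>

lemma gauge_decomposition:
  fixes r :: "nat \<Rightarrow> nat \<Rightarrow> nat \<Rightarrow> complex"
  assumes unit: "\<And>a b c. cmod (r a b c) = 1"
    and cocycle: "\<And>l m. 2 \<le> l \<Longrightarrow> l < n \<Longrightarrow> m = Suc l \<Longrightarrow>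
      r l l l * r m m l * r m l m * r l m m = r l l m * r m m m * r m l l * r l m l"
  obtains f g h :: "nat \<Rightarrow> nat \<Rightarrow> complex"
  where "\<And>a b. cmod (f a b) = 1" "\<And>a b. cmod (g a b) = 1" "\<And>a b. cmod (h a b) = 1"
    "\<And>a b c. adj a b \<Longrightarrow> adj b c \<Longrightarrow> adj c a \<Longrightarrow> r a b c = f a b * g b c * h c a"
proof -
  have nz: "r a b c \<noteq> 0" for a b c using unit[of a b c] by auto
  define f where "f = (\<lambda>a b. if a = b then r a a a
    else if a < b then 1 else r a b b * r a a a * r b a b / r a a b)"
  define g where "g = (\<lambda>a b. if a = b then 1
    else if a < b then r b a b * r b b a / (r b a a * r b b b * r a b a) else r b a b)"
  define h where "h = (\<lambda>a b. if a = b then 1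
    else if a < b then r b b a / (r b b b * r a b a) else r b a a)"
  show thesis
  proof (rule that[of f g h])
    show "cmod (f a b) = 1" "cmod (g a b) = 1" "cmod (h a b) = 1" for a b
      by (auto simp: f_def g_def h_def unit norm_mult norm_divide)
  next
    fix a b c assume "adj a b" "adj b c" "adj c a"
    then show "r a b c = f a b * g b c * h c a"
    proof (cases rule: level_triangle_cases)
      case (vertex p)
      then show ?thesis by (simp add: f_def g_def h_def)
    next
      case (low l)
      then show ?thesis
        using cocycle[of l "Suc l"] nz
        by (auto simp: f_def g_def h_def field_simps)
    next
      case (high l)
      then show ?thesis using nz by (auto simp: f_def g_def h_def field_simps)
    qed
  qed
qed

text \<open>
  In the type II equation at \<open>l, l, m, m\<close> the moduli contribute \<open>T\<close> and \<open>- T\<close>, with \<open>T \<noteq> 0\<close>, by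
  \<open>II_square_identity\<close>. So the two products of four phases must be equal.
\<close>

lemma phase_cocycle:
  assumes II: "level_II w" and l: "2 \<le> l" "l < n" and m: "m = Suc l"
    and r: "\<And>a b c. adj a b \<Longrightarrow> adj b c \<Longrightarrow> adj c a \<Longrightarrow> w a b c = r a b c * complex_of_real (V a b c)"
    and unit: "\<And>a b c. cmod (r a b c) = 1"
  shows "r l l l * r m m l * r m l m * r l m m = r l l m * r m m m * r m l l * r l m l"
proof -
  have adj: "adj l l" "adj l m" "adj m l" "adj m m" using l m by (auto simp: adj_def)
  have cnj: "cnj (r a b c) = inverse (r a b c)" for a b c
    using unit[of a b c] complex_norm_square[of "r a b c"] by (metis inverse_unique of_real_1 power_one)
  have nz: "r a b c \<noteq> 0" for a b c using unit[of a b c] by auto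
  define T where "T = gam l * (beta l)\<^sup>2 * alpha l / weight l"
  have T: "beta l * (alpha l)\<^sup>2 * gam m / weight m = - T"
    using II_square_identity[of l] l by (simp add: T_def m)
  have "T \<noteq> 0"
    using gam_nonzero[of l] beta_nonzero[of l] alpha_nonzero[of l] weight_pos[of l] l by (simp add: T_def)
  have V: "V l l l = gam l" "V m m m = gam m"
    "V l l m = beta l" "V l m l = beta l" "V m l l = beta l"
    "V l m m = alpha l" "V m l m = alpha l" "V m m l = alpha l"
    using l by (auto simp: V_level m)
  have "(\<Sum>c\<in>common {l, l, m, m}.
        of_real (inverse (weight c)) * w l l c * cnj (w m l c) * w m m c * cnj (w l m c)) = 0"
    using II[unfolded level_II_def common_neighbours_eq, rule_format, OF adj(1,3,4,2)] m by simp
  moreover have "common {l, l, m, m} = common {l, Suc l}" by (simp add: m)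
  ultimately have "of_real (inverse (weight l)) * w l l l * cnj (w m l l) * w m m l * cnj (w l m l)
      + of_real (inverse (weight m)) * w l l m * cnj (w m l m) * w m m m * cnj (w l m m) = 0"
    using l by (simp add: sum_common_edge m)
  then have "complex_of_real T * (r l l l * inverse (r m l l) * r m m l * inverse (r l m l))
      + complex_of_real (beta l * (alpha l)\<^sup>2 * gam m / weight m)
        * (r l l m * inverse (r m l m) * r m m m * inverse (r l m m)) = 0"
    unfolding T_def
    by (simp add: r adj V cnj power2_eq_square divide_inverse mult_ac)
  then have "r l l l * inverse (r m l l) * r m m l * inverse (r l m l)
      = r l l m * inverse (r m l m) * r m m m * inverse (r l m m)"
    using \<open>T \<noteq> 0\<close> unfolding T by simp
  then show ?thesis using nz by (simp add: field_simps)
qed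

fun edge_phase :: "(nat \<Rightarrow> nat \<Rightarrow> complex) \<Rightarrow> (nat \<Rightarrow> nat \<Rightarrow> complex) \<Rightarrow> (nat \<Rightarrow> nat \<Rightarrow> complex) \<Rightarrow>
    dvertex \<times> dvertex \<Rightarrow> complex" where
  "edge_phase f g h (vi a, vj b) = f a b"
| "edge_phase f g h (vj a, vk b) = g a b"
| "edge_phase f g h (vk a, vi b) = h a b"
| "edge_phase f g h _ = 1"

text \<open>
  Every block of edges has size one, so a unitary matrix is a phase. The relation is required on one
  rotation of each triangle only, because cell systems are invariant under rotation.
\<close>

lemma equivalent_by_edge_phases:
  assumes W1: "Dstar_cell_system n W1" and W2: "Dstar_cell_system n W2"
    and unit: "\<And>a b. cmod (f a b) = 1" "\<And>a b. cmod (g a b) = 1" "\<And>a b. cmod (h a b) = 1"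
    and fgh: "\<And>a b c. adj a b \<Longrightarrow> adj b c \<Longrightarrow> adj c a \<Longrightarrow>
      cell_at W1 (vi a) (vj b) (vk c) = f a b * g b c * h c a * cell_at W2 (vi a) (vj b) (vk c)"
  shows "Dstar_equivalent n W1 W2"
proof -
  define u where "u = edge_phase f g h"
  have u1: "cmod (u e) = 1" for e
    unfolding u_def by (cases "(f, g, h, e)" rule: edge_phase.cases) (simp_all add: unit)
  have uu: "u e * cnj (u e) = 1" "cnj (u e) * u e = 1" for e
    using u1[of e] complex_norm_square[of "u e"] by (simp_all add: mult.commute)
  have single: "edges (Dstar n) s t = {e}" if "e \<in> edges (Dstar n) s t" for e s t
    using that by (rule Dstar_edgeE) (use that in \<open>auto simp: edges_Dstar split: if_splits\<close>)
  have "edge_unitary (Dstar n) (\<lambda>e e'. u e)"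
    unfolding edge_unitary_def
  proof (intro ballI)
    fix s t e e' assume e: "e \<in> edges (Dstar n) s t" and e': "e' \<in> edges (Dstar n) s t"
    then have "e' = e" using single[OF e] by simp
    then show "(\<Sum>\<tau>\<in>edges (Dstar n) s t. u e * cnj (u e')) = of_bool (e = e') \<and>
        (\<Sum>\<tau>\<in>edges (Dstar n) s t. cnj (u \<tau>) * u \<tau>) = of_bool (e = e')"
      by (simp add: single[OF e] uu)
  qed
  moreover have "W1 e1 e2 e3 = u e1 * u e2 * u e3 * W2 e1 e2 e3"
    if tri: "triangle (Dstar n) e1 e2 e3" for e1 e2 e3
  proof -
    have std: "W1 (vi a, vj b) (vj b, vk c) (vk c, vi a)
        = u (vi a, vj b) * u (vj b, vk c) * u (vk c, vi a) * W2 (vi a, vj b) (vj b, vk c) (vk c, vi a)"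
      if "adj a b" "adj b c" "adj c a" for a b c
      using fgh[OF that] by (simp add: u_def cell_at_def)
    have rot: "W1 e1 e2 e3 = W1 e2 e3 e1" "W2 e1 e2 e3 = W2 e2 e3 e1" if "triangle (Dstar n) e1 e2 e3" for e1 e2 e3
      using W1 W2 that unfolding cell_system_def rotation_invariant_def by blast+
    have cyc: "triangle (Dstar n) e2 e3 e1" using tri by (auto simp: triangle_def)
    from tri obtain X Y Z a b c where t: "colouring X Y Z" "adj a b" "adj b c" "adj c a"
      "e1 = (X a, Y b)" "e2 = (Y b, Z c)" "e3 = (Z c, X a)" by (rule Dstar_triangleE)
    from t(1) consider "X = vi" "Y = vj" "Z = vk" | "X = vj" "Y = vk" "Z = vi" | "X = vk" "Y = vi" "Z = vj"
      by (auto simp: colouring_def)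
    then show ?thesis
    proof cases
      case 1
      then show ?thesis using std[OF t(2-4)] t(5-7) by simp
    next
      case 2
      then show ?thesis using std[OF t(4,2,3)] t(5-7) rot[OF tri] rot[OF cyc] by (simp add: mult_ac)
    next
      case 3
      then show ?thesis using std[OF t(3,4,2)] t(5-7) rot[OF tri] by (simp add: mult_ac)
    qed
  qed
  moreover have "triangle (Dstar n) e1 e2 e3"
    if "e1 \<in> edges (Dstar n) i j" "e2 \<in> edges (Dstar n) j k" "e3 \<in> edges (Dstar n) k i" for e1 e2 e3 i j k
    using that by (auto simp: edges_def triangle_def)
  ultimately show ?thesis
    unfolding cell_equivalent_def using W1 W2
    by (intro conjI exI[of _ "\<lambda>e e'. u e"]) (simp_all add: single)
qed

lemma symmetric_solution_unique:
  assumes W: "Z3_symmetric_solution n W"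
  shows "Dstar_equivalent n W (Dstar_solution n)"
proof -
  have c: "colouring vi vj vk" by (simp add: colouring_def)
  define w where "w = (\<lambda>a b c. cell_at W (vi a) (vj b) (vk c))"
  have WC: "Dstar_cell_system n W" using W by (simp add: Z3_symmetric_solution_def)
  have I: "level_I w" and II: "level_II w"
    using WC c unfolding cell_system_def type_I_levels type_II_levels w_def by blast+
  have sym: "cmod (w a b d) = cmod (w b d a)" if "adj a b" "adj b d" "adj d a" for a b d
    using W triangle_Dstar[OF c that] unfolding Z3_symmetric_solution_def w_def by blast
  note moduli = cell_moduli[OF I II sym]
  \<comment> \<open>The value 1 off the triangles keeps r of absolute value one everywhere.\<close>
  define r where "r = (\<lambda>a b d. if adj a b \<and> adj b d \<and> adj d a then w a b d / of_real (V a b d) else 1)"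
  have unit: "cmod (r a b d) = 1" for a b d
    using moduli V_nonzero by (simp add: r_def norm_divide)
  have wr: "w a b d = r a b d * of_real (V a b d)" if "adj a b" "adj b d" "adj d a" for a b d
    using V_nonzero[OF that] that by (simp add: r_def)
  obtain f g h where fgh: "\<And>a b. cmod (f a b) = 1" "\<And>a b. cmod (g a b) = 1" "\<And>a b. cmod (h a b) = 1"
    "\<And>a b d. adj a b \<Longrightarrow> adj b d \<Longrightarrow> adj d a \<Longrightarrow> r a b d = f a b * g b d * h d a"
    using gauge_decomposition[of r] unit phase_cocycle[OF II _ _ _ wr unit] by blast
  show ?thesis
  proof (rule equivalent_by_edge_phases[OF WC Dstar_solution_cell_system fgh(1-3)])
    fix a b d assume "adj a b" "adj b d" "adj d a"
    then show "cell_at W (vi a) (vj b) (vk d)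
        = f a b * g b d * h d a * cell_at (Dstar_solution n) (vi a) (vj b) (vk d)"
      using wr fgh(4) by (simp add: w_def cell_at_solution[OF c])
  qed
qed

end

theorem theorem8p1:
  fixes n :: nat
  assumes "2 \<le> n"
  shows "Z3_symmetric_solution n (Dstar_solution n) \<and>
    (\<forall>W. Z3_symmetric_solution n W \<longrightarrow> Dstar_equivalent n W (Dstar_solution n))"
  using Dstar_solution_symmetric[OF assms] symmetric_solution_unique[OF assms] by blast

end
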